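(* Let $d \ge 2$ be an integer and let $X=\mathrm{SL}_d(\mathbb{R})/\mathrm{SL}_d(\mathbb{Z})$. There exist an uncountable, dense and measurable subset $S \subset X$ and a symmetric probability distribution $\mu$ on $\mathrm{SL}_d(\mathbb{R})$ which has no atoms, has full support, and is such that, given $(\gamma_n)_n\sim \mu^{\otimes\mathbb{N}}$ (an i.i.d. sequence of law $\mu$), we have $$\mathbb{P}\left(\forall x \in S,\ \gamma_1\cdots\gamma_n \cdot x \underset{n \to \infty}{\longrightarrow} \infty \right) = 1.$$
   Context: A probability measure $\mu$ on $\mathrm{SL}_d(\mathbb{R})$ is symmetric if it is invariant under push-forward by $\gamma\mapsto\gamma^{-1}$; full support means that its support equals $\mathrm{SL}_d(\mathbb{R})$. The space $X$ carries the quotient topology and the left-multiplication action of $\mathrm{SL}_d(\mathbb{R})$. A sequence in $X$ tends to $\infty$ if it eventually leaves every compact subset of $X$. *)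

theory Defs
  imports "HOL-Probability.Probability" "HOL-Algebra.Left_Coset"
begin

definition SL :: "(real^'n^'n) monoid" where
  "SL = \<lparr>carrier = {A. det A = 1}, mult = (**), one = mat 1\<rparr>"

definition SLZ :: "(real^'n^'n) set" where
  "SLZ = {A. det A = 1 \<and> (\<forall>i j. A $ i $ j \<in> \<int>)}"

lemma SL_simps [simp]:
  "A \<in> carrier SL \<longleftrightarrow> det A = 1"
  "A \<otimes>\<^bsub>SL\<^esub> B = A ** B"
  "\<one>\<^bsub>SL\<^esub> = mat 1"
  by (auto simp: SL_def)

lemma matrix_inv_SL:
  fixes A :: "real^'n^'n"
  assumes "det A = 1"
  shows "A ** matrix_inv A = mat 1" "matrix_inv A ** A = mat 1" "det (matrix_inv A) = 1"
proof -
  have inv: "invertible A"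
    using assms by (simp add: invertible_det_nz)
  then have ex: "\<exists>B. A ** B = mat 1 \<and> B ** A = mat 1"
    by (simp add: invertible_def)
  have both: "A ** matrix_inv A = mat 1 \<and> matrix_inv A ** A = mat 1"
    unfolding matrix_inv_def by (rule someI_ex[OF ex])
  then show 1: "A ** matrix_inv A = mat 1" and "matrix_inv A ** A = mat 1"
    by auto
  show "det (matrix_inv A) = 1"
    using arg_cong[OF 1, of det] assms by (simp add: det_mul)
qed

lemma group_SL: "group (SL :: (real^'n^'n) monoid)"
proof (rule groupI)
  fix A :: "real^'n^'n" assume "A \<in> carrier SL"
  then show "\<exists>B\<in>carrier SL. B \<otimes>\<^bsub>SL\<^esub> A = \<one>\<^bsub>SL\<^esub>"
    using matrix_inv_SL[of A] by auto
qed (auto simp: det_mul matrix_mul_assoc)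

lemma m_inv_SL:
  fixes A :: "real^'n^'n"
  assumes "A \<in> carrier SL"
  shows "inv\<^bsub>SL\<^esub> A = matrix_inv A"
  using assms matrix_inv_SL[of A] by (intro group.inv_equality[OF group_SL]) auto

lemma det_Ints:
  fixes A :: "real^'n^'n"
  assumes "\<And>i j. A $ i $ j \<in> \<int>"
  shows "det A \<in> \<int>"
  unfolding det_def using assms by (intro Ints_sum Ints_mult Ints_prod) auto

lemma subgroup_SLZ: "subgroup SLZ (SL :: (real^'n^'n) monoid)"
proof (rule group.subgroupI[OF group_SL])
  show "SLZ \<subseteq> carrier (SL :: (real^'n^'n) monoid)"
    by (auto simp: SLZ_def)
  have "mat 1 \<in> (SLZ :: (real^'n^'n) set)"
    by (simp add: SLZ_def) (simp add: mat_def)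
  then show "SLZ \<noteq> ({} :: (real^'n^'n) set)"
    by blast
next
  fix A :: "real^'n^'n" assume A: "A \<in> SLZ"
  then have det: "det A = 1" and int: "\<And>i j. A $ i $ j \<in> \<int>"
    by (auto simp: SLZ_def)
  have "matrix_inv A $ i $ j \<in> \<int>" for i j
  proof -
    have "A *v (matrix_inv A *v axis j 1) = axis j 1"
      using matrix_inv_SL(1)[OF det] by (simp add: matrix_vector_mul_assoc)
    then have "matrix_inv A *v axis j 1 =
        (\<chi> k. det (\<chi> a b. if b = k then axis j 1 $ a else A $ a $ b) / det A)"
      using cramer[of A "matrix_inv A *v axis j 1" "axis j 1"] det by simp
    then have "(matrix_inv A *v axis j 1) $ i =
        det (\<chi> a b. if b = i then axis j 1 $ a else A $ a $ b)"
      using det by simp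
    also have "\<dots> \<in> \<int>"
      using int by (intro det_Ints) (auto simp: axis_def)
    finally show ?thesis
      by (simp add: matrix_vector_mult_basis column_def)
  qed
  then show "inv\<^bsub>SL\<^esub> A \<in> SLZ"
    using m_inv_SL[of A] matrix_inv_SL(3)[OF det] det by (auto simp: SLZ_def)
next
  fix A B :: "real^'n^'n" assume "A \<in> SLZ" "B \<in> SLZ"
  then show "A \<otimes>\<^bsub>SL\<^esub> B \<in> SLZ"
    by (simp add: SLZ_def det_mul) (simp add: matrix_matrix_mult_def Ints_sum Ints_mult)
qed

definition SL_top :: "(real^'n^'n) topology" where
  "SL_top = top_of_set (carrier SL)"

definition quotient_topology :: "'a topology \<Rightarrow> ('a \<Rightarrow> 'b) \<Rightarrow> 'b topology" where
  "quotient_topology T f =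
     topology (\<lambda>U. U \<subseteq> f ` topspace T \<and> openin T {x \<in> topspace T. f x \<in> U})"

lemma openin_quotient_topology:
  "openin (quotient_topology T f) U \<longleftrightarrow>
     U \<subseteq> f ` topspace T \<and> openin T {x \<in> topspace T. f x \<in> U}"
proof -
  have "istopology (\<lambda>U. U \<subseteq> f ` topspace T \<and> openin T {x \<in> topspace T. f x \<in> U})"
    unfolding istopology_def
  proof (intro conjI allI impI)
    fix U V
    assume U: "U \<subseteq> f ` topspace T \<and> openin T {x \<in> topspace T. f x \<in> U}"
      and V: "V \<subseteq> f ` topspace T \<and> openin T {x \<in> topspace T. f x \<in> V}"
    show "U \<inter> V \<subseteq> f ` topspace T"
      using U by blast
    have "{x \<in> topspace T. f x \<in> U \<inter> V} =
        {x \<in> topspace T. f x \<in> U} \<inter> {x \<in> topspace T. f x \<in> V}"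
      by blast
    then show "openin T {x \<in> topspace T. f x \<in> U \<inter> V}"
      using U V by auto
  next
    fix K
    assume K: "\<forall>U\<in>K. U \<subseteq> f ` topspace T \<and> openin T {x \<in> topspace T. f x \<in> U}"
    then show "\<Union>K \<subseteq> f ` topspace T"
      by blast
    have "{x \<in> topspace T. f x \<in> \<Union>K} = (\<Union>U\<in>K. {x \<in> topspace T. f x \<in> U})"
      by blast
    then show "openin T {x \<in> topspace T. f x \<in> \<Union>K}"
      using K by auto
  qed
  then show ?thesis
    by (simp add: quotient_topology_def)
qed

lemma topspace_quotient_topology: "topspace (quotient_topology T f) = f ` topspace T"
proof
  show "topspace (quotient_topology T f) \<subseteq> f ` topspace T"
    using openin_topspace[of "quotient_topology T f"] unfolding openin_quotient_topology by blast
  have "{x \<in> topspace T. f x \<in> f ` topspace T} = topspace T"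
    by auto
  then have "openin (quotient_topology T f) (f ` topspace T)"
    by (simp add: openin_quotient_topology)
  then show "f ` topspace T \<subseteq> topspace (quotient_topology T f)"
    by (rule openin_subset)
qed

lemma quotient_map_quotient_topology: "quotient_map T (quotient_topology T f) f"
  by (simp add: quotient_map_def topspace_quotient_topology openin_quotient_topology)

definition X_top :: "(real^'n^'n) set topology" where
  "X_top = quotient_topology SL_top (\<lambda>g. g <#\<^bsub>SL\<^esub> SLZ)"

lemma topspace_X_top: "topspace X_top = lcosets\<^bsub>SL\<^esub> SLZ"
  by (auto simp: X_top_def SL_top_def topspace_quotient_topology LCOSETS_def)

text \<open>The action of \<open>g\<close> on a coset \<open>x\<close> is the translate \<open>g <#\<^bsub>SL\<^esub> x = {g ** h | h. h \<in> x}\<close>:\<close>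

lemma action_coset:
  fixes g h :: "real^'n^'n"
  shows "g <#\<^bsub>SL\<^esub> (h <#\<^bsub>SL\<^esub> SLZ) = (g ** h) <#\<^bsub>SL\<^esub> SLZ"
  by (auto simp: l_coset_def matrix_mul_assoc)

definition borel_of_topology :: "'a topology \<Rightarrow> 'a measure" where
  "borel_of_topology T = sigma (topspace T) {U. openin T U}"

definition SL_borel :: "(real^'n^'n) measure" where
  "SL_borel = restrict_space borel (carrier SL)"

text \<open>A probability distribution on \<open>SL\<^sub>d(\<real>)\<close>, as opposed to one on the space of all matrices.\<close>

definition SL_prob :: "(real^'n^'n) measure \<Rightarrow> bool" where
  "SL_prob \<mu> \<longleftrightarrow> prob_space \<mu> \<and> space \<mu> = carrier SL \<and> sets \<mu> = sets SL_borel"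

definition symmetric_measure :: "(real^'n^'n) measure \<Rightarrow> bool" where
  "symmetric_measure \<mu> \<longleftrightarrow> distr \<mu> \<mu> (\<lambda>g. inv\<^bsub>SL\<^esub> g) = \<mu>"

definition no_atoms :: "'a measure \<Rightarrow> bool" where
  "no_atoms M \<longleftrightarrow> (\<forall>x\<in>space M. emeasure M {x} = 0)"

definition measure_support :: "'a topology \<Rightarrow> 'a measure \<Rightarrow> 'a set" where
  "measure_support T M = {x \<in> topspace T. \<forall>U. openin T U \<and> x \<in> U \<longrightarrow> emeasure M U > 0}"

text \<open>Convergence to infinity: the sequence eventually leaves every compact set.\<close>

definition tends_to_infinity :: "'a topology \<Rightarrow> (nat \<Rightarrow> 'a) \<Rightarrow> bool" where
  "tends_to_infinity T s \<longleftrightarrow> (\<forall>K. compactin T K \<longrightarrow> (\<forall>\<^sub>F n in sequentially. s n \<notin> K))"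

text \<open>
  With the sequence indexed from \<open>0\<close>, \<open>prefix_prod \<gamma> n = \<gamma> 0 ** \<gamma> 1 ** \<dots> ** \<gamma> (n - 1)\<close>: each new
  factor is appended on the right, so that it is the first one to act on a point.
\<close>

primrec prefix_prod :: "(nat \<Rightarrow> real^'n^'n) \<Rightarrow> nat \<Rightarrow> real^'n^'n" where
  "prefix_prod \<gamma> 0 = mat 1"
| "prefix_prod \<gamma> (Suc n) = prefix_prod \<gamma> n ** \<gamma> n"

end

theory Submission
  imports Defs "HOL-Real_Asymp.Real_Asymp"
begin

text \<open>
  The measure \<open>\<mu>\<close> has extremely slowly decaying tails over a sequence of \<^emph>\<open>levels\<close>, so that almost
  surely, for all large \<open>n\<close>, the largest level \<open>j\<close> among the first \<open>n\<close> factors is at least \<open>n\<close> and is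
  attained exactly once. The factor attaining it is, up to a unipotent, \<open>D\<close> or \<open>D\<^sup>-\<^sup>1\<close> with
  \<open>D = diag(b, 1/b, 1, \<dots>, 1)\<close>, where \<open>b\<close> is huge compared to all factors of lower level.
  The unipotents and the points of \<open>S\<close> involve Liouville numbers and the remaining matrices are rational,
  so seen from level \<open>j\<close> everything which acts before \<open>D\<close> maps \<open>\<int>\<^sup>d\<close> very close to a rational lattice
  whose denominators are small compared to \<open>b\<close>. Such a lattice contains small multiples of all basis
  vectors, and both \<open>D\<close> and \<open>D\<^sup>-\<^sup>1\<close> contract one of them; the factors acting after \<open>D\<close> are too small to
  compensate. Hence the shortest vector of the lattice tends to \<open>0\<close>, for all points of \<open>S\<close> at once.
\<close>


section \<open>Matrices\<close>

text \<open>The obstacle is that one almost sure event must serve uncountably many points while the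
  law is symmetric and spread over the whole group. So the event, \<open>has_record\<close>, speaks
  of the factors only; a point enters through a threshold alone, the level beyond which it has
  nearly rational representatives, and the representative may change with the level. Symmetry comes
  from a fair coin that decides between a matrix and its inverse, absence of atoms from the random
  Liouville parameter of the unipotent, and full support from a dense sequence of rational matrices
  placed at levels \<open>2 ^ i\<close>, so sparse that records eventually avoid them. The geometry
  asks for a record level of at least \<open>n\<close> because heights and errors grow exponentially
  with the number of factors, and the constants at level \<open>j\<close> leave room for about
  \<open>j\<close> of them. The tail, of order \<open>1 / ln (ln m)\<close>, gives much more, a
  maximum of at least \<open>2 ^ n\<close>; this surplus makes ties and sparse levels summably
  unlikely.\<close>

lemma power2_norm_vec: "(norm (x :: 'a::real_inner^'n))\<^sup>2 = (\<Sum>i\<in>UNIV. (norm (x $ i))\<^sup>2)"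
  unfolding power2_norm_eq_inner by (rule inner_vec_def)

text \<open>The norm of this type is the Frobenius norm, so Cauchy-Schwarz on each entry, an inner
  product of a row with a column, gives the constant 1.\<close>

lemma norm_matrix_mult_le:
  fixes A :: "real^'k^'m" and B :: "real^'n^'k"
  shows "norm (A ** B) \<le> norm A * norm B"
proof -
  have "(norm (A ** B))\<^sup>2 = (\<Sum>i\<in>UNIV. \<Sum>j\<in>UNIV. (inner (A $ i) (column j B))\<^sup>2)"
    unfolding power2_norm_vec by (simp add: matrix_matrix_mult_def inner_vec_def column_def)
  also have "\<dots> \<le> (\<Sum>i\<in>UNIV. \<Sum>j\<in>UNIV. (norm (A $ i))\<^sup>2 * (norm (column j B))\<^sup>2)"
    by (intro sum_mono) (metis Cauchy_Schwarz_ineq power2_norm_eq_inner)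
  also have "\<dots> = (\<Sum>i\<in>UNIV. (norm (A $ i))\<^sup>2) * (\<Sum>j\<in>UNIV. (norm (column j B))\<^sup>2)"
    by (simp add: sum_product)
  also have "(\<Sum>i\<in>UNIV. (norm (A $ i))\<^sup>2) = (norm A)\<^sup>2"
    by (rule power2_norm_vec[symmetric])
  also have "(\<Sum>j\<in>UNIV. (norm (column j B))\<^sup>2) = (norm B)\<^sup>2"
    unfolding power2_norm_vec by (subst sum.swap) (simp add: column_def)
  finally show ?thesis
    by (metis mult_nonneg_nonneg norm_ge_zero power2_le_imp_le power_mult_distrib)
qed

lemma norm_matrix_vector_mult_le:
  fixes A :: "real^'n^'m"
  shows "norm (A *v x) \<le> norm A * norm x"
proof -
  have "(norm (A *v x))\<^sup>2 = (\<Sum>i\<in>UNIV. (inner (A $ i) x)\<^sup>2)"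
    unfolding power2_norm_vec[of "A *v x"] by (simp add: matrix_vector_mult_def inner_vec_def)
  also have "\<dots> \<le> (\<Sum>i\<in>UNIV. (norm (A $ i))\<^sup>2 * (norm x)\<^sup>2)"
    by (intro sum_mono) (metis Cauchy_Schwarz_ineq power2_norm_eq_inner)
  also have "\<dots> = (norm A * norm x)\<^sup>2"
    by (simp add: power_mult_distrib power2_norm_vec[of A] sum_distrib_right)
  finally show ?thesis
    by (metis mult_nonneg_nonneg norm_ge_zero power2_le_imp_le)
qed

lemma bounded_bilinear_matrix_mult:
  "bounded_bilinear ((**) :: real^'k^'m \<Rightarrow> real^'n^'k \<Rightarrow> real^'n^'m)"
proof
  show "\<exists>K. \<forall>(a :: real^'k^'m) (b :: real^'n^'k). norm (a ** b) \<le> norm a * norm b * K"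
    using norm_matrix_mult_le by (intro exI[of _ 1]) auto
qed (auto simp: matrix_matrix_mult_def vec_eq_iff sum.distrib algebra_simps sum_distrib_left)

lemmas continuous_on_matrix_mult [continuous_intros] =
  bounded_bilinear.continuous_on[OF bounded_bilinear_matrix_mult]

lemma continuous_on_det [continuous_intros]:
  fixes f :: "'a::topological_space \<Rightarrow> real^'n^'n"
  assumes "continuous_on S f"
  shows "continuous_on S (\<lambda>x. det (f x))"
  unfolding det_def by (intro continuous_intros assms)

lemma matrix_inv_eqI:
  fixes A :: "real^'n^'n"
  assumes "A ** B = mat 1"
  shows "matrix_inv A = B"
proof -
  have "B ** A = mat 1"
    using assms by (simp add: matrix_left_right_inverse)
  moreover have "A ** matrix_inv A = mat 1"
    unfolding matrix_inv_def
    by (rule someI2[where P="\<lambda>A'. A ** A' = mat 1 \<and> A' ** A = mat 1" and a=B])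
      (use assms calculation in auto)
  ultimately show ?thesis
    by (metis matrix_mul_assoc matrix_mul_lid matrix_mul_rid)
qed

lemma matrix_inv_matrix_inv:
  fixes A :: "real^'n^'n"
  assumes "det A = 1"
  shows "matrix_inv (matrix_inv A) = A"
  by (intro matrix_inv_eqI matrix_inv_SL assms)

lemma matrix_inv_mult:
  fixes A B :: "real^'n^'n"
  assumes "det A = 1" "det B = 1"
  shows "matrix_inv (A ** B) = matrix_inv B ** matrix_inv A"
proof (rule matrix_inv_eqI)
  have "(A ** B) ** (matrix_inv B ** matrix_inv A) = A ** (B ** matrix_inv B) ** matrix_inv A"
    by (simp add: matrix_mul_assoc)
  then show "(A ** B) ** (matrix_inv B ** matrix_inv A) = mat 1"
    using assms by (simp add: matrix_inv_SL)
qed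

text \<open>Cramer's rule. In this form inversion is visibly continuous on determinant 1 and visibly
  preserves rational entries.\<close>

lemma matrix_inv_nth:
  fixes A :: "real^'n^'n"
  assumes "det A = 1"
  shows "matrix_inv A $ i $ j = det (\<chi> a b. if b = i then axis j 1 $ a else A $ a $ b)"
proof -
  have "A *v (matrix_inv A *v axis j 1) = axis j 1"
    using matrix_inv_SL(1)[OF assms] by (simp add: matrix_vector_mul_assoc)
  then have "matrix_inv A *v axis j 1 =
      (\<chi> k. det (\<chi> a b. if b = k then axis j 1 $ a else A $ a $ b) / det A)"
    using cramer[of A "matrix_inv A *v axis j 1" "axis j 1"] assms by simp
  then have "(matrix_inv A *v axis j 1) $ i =
      det (\<chi> a b. if b = i then axis j 1 $ a else A $ a $ b)"
    using assms by simp
  then show ?thesis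
    by (simp add: matrix_vector_mult_basis column_def)
qed

lemma continuous_on_matrix_inv: "continuous_on {A :: real^'n^'n. det A = 1} matrix_inv"
proof -
  have "continuous_on {A :: real^'n^'n. det A = 1}
      (\<lambda>A. if b = i then (axis j 1 :: real^'n) $ a else A $ a $ b)" for i j a b :: 'n
    by (cases "b = i"; simp; intro continuous_intros)
  then have "continuous_on {A :: real^'n^'n. det A = 1}
      (\<lambda>A. \<chi> i j. det (\<chi> a b. if b = i then (axis j 1 :: real^'n) $ a else A $ a $ b))"
    by (intro continuous_on_vec_lambda continuous_on_det)
  then show ?thesis
    by (rule continuous_on_eq) (auto simp: vec_eq_iff matrix_inv_nth)
qed

lemma closed_SL: "closed {A :: real^'n^'n. det A = 1}"
  by (intro closed_Collect_eq continuous_intros)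

text \<open>Correcting the determinant through a single row, rather than by a root of
  \<open>det A\<close> applied to the whole matrix, keeps rational entries rational.\<close>

lemma det_scale_row_SL:
  fixes A :: "real^'n^'n"
  assumes "det A \<noteq> 0"
  shows "det (\<chi> i j. if i = p then A $ i $ j / det A else A $ i $ j) = 1"
proof -
  have "(\<chi> i j. if i = p then A $ i $ j / det A else A $ i $ j) =
      (\<chi> i. if i = p then (1 / det A) *s (A $ i) else A $ i)"
    by (auto simp: vec_eq_iff)
  moreover have "(\<chi> i. if i = p then A $ i else A $ i) = A"
    by (simp add: vec_eq_iff)
  ultimately show ?thesis
    using det_row_mul[of p "1 / det A" "\<lambda>i. A $ i" "\<lambda>i. A $ i"] assms by simp
qed

lemma det_Rats:
  fixes A :: "real^'n^'n"
  assumes "\<And>i j. A $ i $ j \<in> \<rat>"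
  shows "det A \<in> \<rat>"
proof -
  have *: "of_int (sign s) * (\<Prod>i\<in>UNIV. A $ i $ s i) \<in> \<rat>" for s
    by (intro Rats_mult) (induction rule: infinite_finite_induct[of _ "UNIV :: 'n set"], auto simp: assms)
  have "(\<Sum>s\<in>P. of_int (sign s) * (\<Prod>i\<in>UNIV. A $ i $ s i)) \<in> \<rat>" for P
    by (induction P rule: infinite_finite_induct) (use * in auto)
  then show ?thesis
    unfolding det_def by blast
qed

text \<open>A rational matrix close to \<open>g\<close> has determinant close to \<open>1\<close>, and dividing one row by
  this determinant does not move it far.\<close>

lemma rational_SL_dense:
  fixes g :: "real^'n^'n"
  assumes "det g = 1" "open U" "g \<in> U"
  shows "\<exists>r\<in>U. det r = 1 \<and> (\<forall>i j. r $ i $ j \<in> \<rat>)"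
proof -
  define p :: 'n where "p = undefined"
  define F :: "real^'n^'n \<Rightarrow> real^'n^'n"
    where "F = (\<lambda>A. \<chi> i j. if i = p then A $ i $ j / det A else A $ i $ j)"
  have contF: "continuous_on {A. det A \<noteq> 0} F"
  proof -
    have "continuous_on {A. det A \<noteq> 0} (\<lambda>A::real^'n^'n. if i = p then A $ i $ j / det A else A $ i $ j)" for i j
      by (cases "i = p"; simp; intro continuous_intros; simp)
    then show ?thesis
      unfolding F_def by (intro continuous_on_vec_lambda)
  qed
  have "open {A :: real^'n^'n. det A \<noteq> 0}"
    by (intro open_Collect_neq continuous_intros)
  then have opn: "open ({A. det A \<noteq> 0} \<inter> F -` U)"
    using contF assms(2) continuous_on_open_vimage[of "{A. det A \<noteq> 0}" F] by (simp add: Int_commute)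
  have "F g = g"
    using assms(1) by (auto simp: F_def vec_eq_iff)
  then have "g \<in> {A. det A \<noteq> 0} \<inter> F -` U"
    using assms by auto
  then obtain e where e: "e > 0" "ball g e \<subseteq> {A. det A \<noteq> 0} \<inter> F -` U"
    using opn openE by blast
  \<comment> \<open>Summed over all entries this tolerance is \<open>e / 2\<close>, so
    \<open>B\<close> lands strictly inside the ball.\<close>
  define c where "c = e / (2 * (real CARD('n) * real CARD('n)))"
  have "c > 0" using e by (simp add: c_def)
  then have "\<forall>i j. \<exists>q \<in> \<rat>. \<bar>q - g $ i $ j\<bar> < c"
    by (force intro: rational_approximation)
  then obtain B where B: "\<And>i j. B$i$j \<in> \<rat>" "\<And>i j. \<bar>B$i$j - g $ i $ j\<bar> < c"
    by (auto simp: lambda_skolem Bex_def)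
  have "norm (B - g) \<le> (\<Sum>i\<in>UNIV. norm ((B - g) $ i))"
    unfolding norm_vec_def[of "B - g"] by (rule L2_set_le_sum) simp
  also have "\<dots> \<le> (\<Sum>i\<in>(UNIV::'n set). \<Sum>j\<in>(UNIV::'n set). c)"
    by (intro sum_mono order_trans[OF norm_le_l1_cart]) (auto intro!: less_imp_le B)
  also have "\<dots> < e"
    using e by (simp add: c_def)
  finally have "B \<in> ball g e"
    by (simp add: dist_norm norm_minus_commute)
  then have "det B \<noteq> 0" "F B \<in> U"
    using e by auto
  moreover have "\<forall>i j. F B $ i $ j \<in> \<rat>"
    using B(1) det_Rats[of B] by (auto simp: F_def)
  ultimately show ?thesis
    using det_scale_row_SL[of B p] by (intro bexI[of _ "F B"]) (auto simp: F_def)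
qed

section \<open>The space of lattices\<close>

lemma mat_1_SLZ: "mat 1 \<in> (SLZ :: (real^'n^'n) set)"
  using subgroup.one_closed[OF subgroup_SLZ] by simp

lemma lcoset_SLZ_mult:
  fixes g s :: "real^'n^'n"
  assumes "s \<in> SLZ"
  shows "(g ** s) <#\<^bsub>SL\<^esub> SLZ = g <#\<^bsub>SL\<^esub> SLZ"
proof -
  have "det s = 1"
    using assms by (simp add: SLZ_def)
  then have "s <#\<^bsub>SL\<^esub> SLZ = SLZ"
    using group.coset_join3[OF group_SL _ subgroup_SLZ assms] by simp
  then show ?thesis
    using action_coset[of g s] by simp
qed

lemma lcoset_SLZ_eq_iff:
  fixes g h :: "real^'n^'n"
  shows "g <#\<^bsub>SL\<^esub> SLZ = h <#\<^bsub>SL\<^esub> SLZ \<longleftrightarrow> (\<exists>s\<in>SLZ. h = g ** s)"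
proof
  assume eq: "g <#\<^bsub>SL\<^esub> SLZ = h <#\<^bsub>SL\<^esub> SLZ"
  have "h \<in> h <#\<^bsub>SL\<^esub> SLZ"
    using mat_1_SLZ by (force simp: l_coset_def)
  then show "\<exists>s\<in>SLZ. h = g ** s"
    unfolding eq[symmetric] by (auto simp: l_coset_def)
qed (auto simp: lcoset_SLZ_mult)

lemma topspace_X_top_eq:
  "topspace X_top = (\<lambda>g. g <#\<^bsub>SL\<^esub> SLZ) ` {g :: real^'n^'n. det g = 1}"
  by (simp add: X_top_def topspace_quotient_topology SL_top_def) (simp add: SL_def)

text \<open>The quotient map is open: the matrices with image in that of \<open>V\<close> are those
  that some right translation by \<open>SLZ\<close> moves into \<open>V\<close>, a union of
  preimages of an open set.\<close>

lemma openin_X_top_image: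
  fixes V :: "(real^'n^'n) set"
  assumes "open V"
  shows "openin X_top ((\<lambda>g. g <#\<^bsub>SL\<^esub> SLZ) ` ({g. det g = 1} \<inter> V))"
proof -
  have sub: "(\<lambda>g. g <#\<^bsub>SL\<^esub> SLZ) ` ({g. det g = 1} \<inter> V) \<subseteq>
      (\<lambda>g. g <#\<^bsub>SL\<^esub> SLZ) ` topspace SL_top"
    by (auto simp: SL_top_def)
  have eq: "{g \<in> topspace SL_top. g <#\<^bsub>SL\<^esub> SLZ \<in>
      (\<lambda>g. g <#\<^bsub>SL\<^esub> SLZ) ` ({g. det g = 1} \<inter> V)} =
      carrier SL \<inter> (\<Union>s\<in>SLZ. (\<lambda>g. g ** s) -` V)" (is "?L = ?R")
  proof (intro Set.set_eqI iffI)
    fix g :: "real^'n^'n" assume "g \<in> ?L"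
    then obtain h where "det g = 1" "det h = 1" "h \<in> V" "g <#\<^bsub>SL\<^esub> SLZ = h <#\<^bsub>SL\<^esub> SLZ"
      by (auto simp: SL_top_def)
    then show "g \<in> ?R"
      by (auto simp: lcoset_SLZ_eq_iff)
  next
    fix g :: "real^'n^'n" assume "g \<in> ?R"
    then obtain s where s: "det g = 1" "s \<in> SLZ" "g ** s \<in> V"
      by auto
    then have "det (g ** s) = 1"
      by (simp add: det_mul SLZ_def)
    then show "g \<in> ?L"
      using s lcoset_SLZ_mult[OF s(2), of g]
      by (auto simp: SL_top_def intro!: image_eqI[of _ _ "g ** s"])
  qed
  have "open ((\<lambda>g :: real^'n^'n. g ** s) -` V)" for s
    by (rule open_vimage[OF assms]) (intro continuous_intros)
  then have "openin SL_top (carrier SL \<inter> (\<Union>s\<in>SLZ. (\<lambda>g :: real^'n^'n. g ** s) -` V))"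
    unfolding SL_top_def by (intro openin_open_Int open_UN) auto
  then show ?thesis
    unfolding X_top_def openin_quotient_topology using sub eq by simp
qed

section \<open>Short lattice vectors and divergence to infinity\<close>

definition int_vec :: "real^'n \<Rightarrow> bool" where
  "int_vec z \<longleftrightarrow> (\<forall>i. z $ i \<in> \<int>)"

lemma int_vec_norm_ge_1:
  assumes "int_vec z" "z \<noteq> 0"
  shows "1 \<le> norm z"
proof -
  obtain i where "z $ i \<noteq> 0"
    using assms(2) by (auto simp: vec_eq_iff)
  then have "1 \<le> \<bar>z $ i\<bar>"
    using assms(1) by (auto simp: int_vec_def intro: Ints_nonzero_abs_ge1)
  then show ?thesis
    using component_le_norm_cart[of z i] by linarith
qed

lemma int_vec_SLZ_mult:
  assumes "s \<in> SLZ" "int_vec z"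
  shows "int_vec (s *v z)"
  using assms by (auto simp: int_vec_def SLZ_def matrix_vector_mult_def intro!: Ints_sum Ints_mult)

text \<open>The easy half of Mahler's compactness criterion.\<close>

lemma compactin_X_top_norm_bound:
  fixes K :: "(real^'n^'n) set set"
  assumes "compactin X_top K"
  shows "\<exists>m>0. \<forall>g z. det g = 1 \<and> g <#\<^bsub>SL\<^esub> SLZ \<in> K \<and> int_vec z \<and> z \<noteq> 0 \<longrightarrow> 1 \<le> m * norm (g *v z)"
proof -
  \<comment> \<open>An open exhaustion of the space, increasing in \<open>m\<close>, so a compact
    set lies in a single \<open>W m\<close>. A bound on the inverse of a representative keeps
    lattice vectors away from 0.\<close>
  define W where "W m = (\<lambda>g. g <#\<^bsub>SL\<^esub> SLZ) ` {g :: real^'n^'n. det g = 1 \<and> norm (matrix_inv g) < real m}" for m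
  have "openin X_top (W m)" for m
  proof -
    have "openin (top_of_set {g :: real^'n^'n. det g = 1}) ({g. det g = 1} \<inter> matrix_inv -` ball 0 (real m))"
      by (intro continuous_openin_preimage_gen continuous_on_matrix_inv open_ball)
    then obtain V where "open V" and V: "{g :: real^'n^'n. det g = 1} \<inter> matrix_inv -` ball 0 (real m) = {g. det g = 1} \<inter> V"
      by (auto simp: openin_open)
    have "W m = (\<lambda>g. g <#\<^bsub>SL\<^esub> SLZ) ` ({g :: real^'n^'n. det g = 1} \<inter> V)"
      unfolding W_def V[symmetric] by (rule arg_cong[where f="image _"]) auto
    then show ?thesis
      using openin_X_top_image[OF \<open>open V\<close>] by simp
  qed
  moreover have "K \<subseteq> \<Union>(range W)"
  proof
    fix x assume "x \<in> K"
    then have "x \<in> topspace X_top"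
      using assms compactin_subset_topspace by blast
    then obtain g :: "real^'n^'n" where "det g = 1" "x = g <#\<^bsub>SL\<^esub> SLZ"
      by (auto simp: topspace_X_top_eq)
    moreover obtain m where "norm (matrix_inv g) < real m"
      using reals_Archimedean2 by blast
    ultimately have "x \<in> W m"
      by (auto simp: W_def)
    then show "x \<in> \<Union>(range W)" by blast
  qed
  ultimately obtain F where "finite F" "F \<subseteq> range W" "K \<subseteq> \<Union>F"
    using assms unfolding compactin_def by (metis (no_types, lifting) imageE)
  then obtain I where I: "finite I" "F = W ` I"
    by (metis finite_subset_image)
  \<comment> \<open>The inserted 1 makes \<open>m\<close> positive and covers an empty
    subcover.\<close>
  define m where "m = Max (insert 1 I)"
  have "m \<ge> 1"
    using I by (auto simp: m_def)
  have "K \<subseteq> W m"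
  proof
    fix x assume "x \<in> K"
    then obtain i where "i \<in> I" "x \<in> W i"
      using I \<open>K \<subseteq> \<Union>F\<close> by auto
    moreover have "i \<le> m"
      using I \<open>i \<in> I\<close> by (auto simp: m_def)
    ultimately show "x \<in> W m"
      by (force simp: W_def)
  qed
  have "1 \<le> real m * norm (g *v z)"
    if g1: "det g = 1" and gK: "g <#\<^bsub>SL\<^esub> SLZ \<in> K" and z: "int_vec z" "z \<noteq> 0" for g :: "real^'n^'n" and z
  proof -
    obtain h :: "real^'n^'n" where h: "det h = 1" "norm (matrix_inv h) < real m" "g <#\<^bsub>SL\<^esub> SLZ = h <#\<^bsub>SL\<^esub> SLZ"
      using gK \<open>K \<subseteq> W m\<close> by (auto simp: W_def)
    \<comment> \<open>The bound is claimed for every representative \<open>g\<close>. Passing to the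
      good representative \<open>h\<close> only replaces \<open>z\<close> by \<open>s *v z\<close>,
      again a nonzero integer vector.\<close>
    then obtain s where s: "s \<in> SLZ" "g = h ** s"
      using lcoset_SLZ_eq_iff[of h g] by auto
    then have "matrix_inv h *v (g *v z) = s *v z"
      using h(1) by (simp add: matrix_vector_mul_assoc matrix_mul_assoc matrix_inv_SL)
    moreover have "s *v z \<noteq> 0"
    proof
      assume "s *v z = 0"
      then have "matrix_inv s *v (s *v z) = 0" by simp
      moreover have "det s = 1"
        using s by (simp add: SLZ_def)
      ultimately show False
        using z(2) by (simp add: matrix_vector_mul_assoc matrix_inv_SL)
    qed
    ultimately have "1 \<le> norm (matrix_inv h *v (g *v z))"
      using int_vec_norm_ge_1 int_vec_SLZ_mult[OF s(1) z(1)] by simp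
    also have "\<dots> \<le> norm (matrix_inv h) * norm (g *v z)"
      by (rule norm_matrix_vector_mult_le)
    also have "\<dots> \<le> real m * norm (g *v z)"
      using h(2) by (intro mult_right_mono) auto
    finally show ?thesis .
  qed
  then show ?thesis
    using \<open>m \<ge> 1\<close> by (intro exI[of _ "real m"]) auto
qed

text \<open>A compact set bounds nonzero lattice vectors away from 0, so it cannot contain lattices
  with vectors of length at most \<open>c n\<close> for large \<open>n\<close>. The representative
  and the vector may change with \<open>n\<close>.\<close>

lemma tends_to_infinity_X_topI:
  fixes s :: "nat \<Rightarrow> (real^'n^'n) set"
  assumes "c \<longlonglongrightarrow> (0::real)"
    and "\<forall>\<^sub>F n in sequentially. \<exists>g z. det g = 1 \<and> s n = g <#\<^bsub>SL\<^esub> SLZ \<and> int_vec z \<and> z \<noteq> 0 \<and> norm (g *v z) \<le> c n"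
  shows "tends_to_infinity X_top s"
  unfolding tends_to_infinity_def
proof (intro allI impI)
  fix K :: "(real^'n^'n) set set" assume "compactin X_top K"
  then obtain m where m: "m > 0"
    "\<And>g z. det g = 1 \<Longrightarrow> g <#\<^bsub>SL\<^esub> SLZ \<in> K \<Longrightarrow> int_vec z \<Longrightarrow> z \<noteq> 0 \<Longrightarrow> 1 \<le> m * norm (g *v z)"
    using compactin_X_top_norm_bound by blast
  have "\<forall>\<^sub>F n in sequentially. c n < 1 / m"
    using assms(1) m(1) by (intro order_tendstoD(2)) auto
  with assms(2) show "\<forall>\<^sub>F n in sequentially. s n \<notin> K"
  proof eventually_elim
    case (elim n)
    then obtain g z where g: "det g = 1" "s n = g <#\<^bsub>SL\<^esub> SLZ" "int_vec z" "z \<noteq> 0" "norm (g *v z) \<le> c n"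
      by blast
    have "m * norm (g *v z) \<le> m * c n"
      using g m(1) by (intro mult_left_mono) auto
    also have "\<dots> < 1"
      using elim m(1) by (simp add: field_simps)
    finally show ?case
      using m(2)[of g z] g by force
  qed
qed

section \<open>Matrices close to rational matrices\<close>

text \<open>A single number serves as norm bound and as common denominator, for a matrix and its
  inverse alike. It is therefore multiplicative under products and unaffected by inversion.\<close>

definition int_height :: "real \<Rightarrow> real^'n^'n \<Rightarrow> real^'n^'n \<Rightarrow> bool" where
  "int_height m h h' \<longleftrightarrow> h ** h' = mat 1 \<and> norm h \<le> m \<and> norm h' \<le> m \<and>
     (\<forall>i j. m * h $ i $ j \<in> \<int> \<and> m * h' $ i $ j \<in> \<int>)"

text \<open>Closeness is also asked of the inverses, which makes the set invariant under
  \<open>matrix_inv\<close>, as the symmetry of the law demands.\<close>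

definition near_rational :: "real \<Rightarrow> real \<Rightarrow> (real^'n^'n) set" where
  "near_rational m d = {g. det g = 1 \<and>
     (\<exists>h h'. int_height m h h' \<and> norm (g - h) < d \<and> norm (matrix_inv g - h') < d)}"

lemma int_height_mult:
  assumes "int_height m h h'" "int_height n k k'"
  shows "int_height (m * n) (h ** k) (k' ** h')"
proof -
  have "(h ** k) ** (k' ** h') = h ** (k ** k') ** h'"
    by (simp add: matrix_mul_assoc)
  then have "(h ** k) ** (k' ** h') = mat 1"
    using assms by (simp add: int_height_def)
  moreover have nn: "0 \<le> m" "0 \<le> n"
    using assms norm_ge_zero order_trans unfolding int_height_def by blast+
  have "norm (h ** k) \<le> m * n" "norm (k' ** h') \<le> n * m"
    using assms nn unfolding int_height_def
    by (auto intro!: order_trans[OF norm_matrix_mult_le] mult_mono)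
  moreover have "m * n * (h ** k) $ i $ j \<in> \<int>" for i j
  proof -
    have "m * n * (h ** k) $ i $ j = (\<Sum>l\<in>UNIV. (m * h $ i $ l) * (n * k $ l $ j))"
      by (simp add: matrix_matrix_mult_def sum_distrib_left mult_ac)
    also have "\<dots> \<in> \<int>"
      using assms unfolding int_height_def by (intro Ints_sum Ints_mult[where a = "u * v" and b = "w * x" for u v w x]) auto
    finally show ?thesis .
  qed
  moreover have "m * n * (k' ** h') $ i $ j \<in> \<int>" for i j
  proof -
    have "m * n * (k' ** h') $ i $ j = (\<Sum>l\<in>UNIV. (n * k' $ i $ l) * (m * h' $ l $ j))"
      by (simp add: matrix_matrix_mult_def sum_distrib_left mult_ac)
    also have "\<dots> \<in> \<int>"
      using assms unfolding int_height_def by (intro Ints_sum Ints_mult[where a = "u * v" and b = "w * x" for u v w x]) auto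
    finally show ?thesis .
  qed
  ultimately show ?thesis
    by (auto simp: int_height_def mult.commute)
qed

text \<open>The number is also a denominator, so it is enlarged by integer factors; this is why the
  heights of successive levels are made to divide one another.\<close>

lemma int_height_scale:
  assumes "int_height m h h'" "c \<in> \<int>" "c \<ge> 1"
  shows "int_height (c * m) h h'"
proof -
  have "0 \<le> m"
    using assms(1) norm_ge_zero order_trans unfolding int_height_def by blast
  then have "m \<le> c * m"
    using assms(3) by (simp add: mult_le_cancel_right1)
  moreover have "c * m * h $ i $ j \<in> \<int>" "c * m * h' $ i $ j \<in> \<int>" for i j
    using assms Ints_mult[of c "m * h $ i $ j"] Ints_mult[of c "m * h' $ i $ j"]
    unfolding int_height_def by (auto simp: mult.assoc)
  ultimately show ?thesis
    using assms(1) unfolding int_height_def by auto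
qed

lemma near_rational_det: "g \<in> near_rational m d \<Longrightarrow> det g = 1"
  by (simp add: near_rational_def)

lemma near_rational_mono: "g \<in> near_rational m d \<Longrightarrow> d \<le> e \<Longrightarrow> g \<in> near_rational m e"
  by (fastforce simp: near_rational_def)

lemma near_rational_scale:
  "g \<in> near_rational m d \<Longrightarrow> c \<in> \<int> \<Longrightarrow> c \<ge> 1 \<Longrightarrow> g \<in> near_rational (c * m) d"
  unfolding near_rational_def using int_height_scale by blast

lemma near_rational_inv:
  assumes "g \<in> near_rational m d"
  shows "matrix_inv g \<in> near_rational m d"
proof -
  obtain h h' where "int_height m h h'" "norm (g - h) < d" "norm (matrix_inv g - h') < d" "det g = 1"
    using assms by (auto simp: near_rational_def)
  then have "int_height m h' h \<and> norm (matrix_inv g - h') < d \<and> norm (matrix_inv (matrix_inv g) - h) < d"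
    by (auto simp: int_height_def matrix_inv_matrix_inv matrix_left_right_inverse)
  then show ?thesis
    using \<open>det g = 1\<close> unfolding near_rational_def by (auto simp: matrix_inv_SL)
qed

text \<open>Write the difference as \<open>(A - H) ** B + H ** (B - K)\<close> and bound
  \<open>B\<close>, which is not rational, through \<open>K\<close> by \<open>n + e\<close>.\<close>

lemma norm_mult_diff_less:
  fixes A B H K :: "real^'n^'n"
  assumes "norm (A - H) < d" "norm (B - K) < e" "norm H \<le> m" "norm K \<le> n" "m > 0"
  shows "norm (A ** B - H ** K) < d * n + m * e + d * e"
proof -
  have "A ** B - H ** K = (A - H) ** B + H ** (B - K)"
    by (simp add: bounded_bilinear.diff_left[OF bounded_bilinear_matrix_mult]
        bounded_bilinear.diff_right[OF bounded_bilinear_matrix_mult])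
  then have "norm (A ** B - H ** K) \<le> norm (A - H) * norm B + norm H * norm (B - K)"
    by (metis norm_matrix_mult_le norm_triangle_mono)
  also have "norm B \<le> n + e"
    using norm_triangle_sub[of B K] assms by linarith
  then have "norm (A - H) * norm B \<le> d * (n + e)"
    using assms norm_ge_zero[of "A - H"] norm_ge_zero[of B] by (intro mult_mono) linarith+
  also have "norm H * norm (B - K) \<le> m * norm (B - K)"
    using assms by (intro mult_right_mono) auto
  also have "m * norm (B - K) < m * e"
    using assms by simp
  finally show ?thesis
    by (simp add: algebra_simps)
qed

lemma near_rational_mult:
  assumes "g \<in> near_rational m d" "g2 \<in> near_rational n e" "m > 0" "n > 0"
  shows "g ** g2 \<in> near_rational (m * n) (d * n + m * e + d * e)"
proof -
  obtain h h' where h: "int_height m h h'" "norm (g - h) < d" "norm (matrix_inv g - h') < d" "det g = 1"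
    using assms by (auto simp: near_rational_def)
  obtain k k' where k: "int_height n k k'" "norm (g2 - k) < e" "norm (matrix_inv g2 - k') < e" "det g2 = 1"
    using assms by (auto simp: near_rational_def)
  have "norm (g ** g2 - h ** k) < d * n + m * e + d * e"
    using h k assms by (intro norm_mult_diff_less) (auto simp: int_height_def)
  moreover have "norm (matrix_inv (g ** g2) - k' ** h') < e * m + n * d + e * d"
    unfolding matrix_inv_mult[OF h(4) k(4)]
    using h k assms by (intro norm_mult_diff_less) (auto simp: int_height_def)
  then have "norm (matrix_inv (g ** g2) - k' ** h') < d * n + m * e + d * e"
    by (simp add: algebra_simps)
  ultimately show ?thesis
    using int_height_mult[OF h(1) k(1)] h(4) k(4) unfolding near_rational_def
    by (auto simp: det_mul)
qed

text \<open>Invariant for a product of \<open>n\<close> factors: each costs \<open>m\<close> in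
  height and \<open>m ^ 2\<close> in error. The exponents do not start at 0 because the empty
  product can have norm above 1 and closeness is strict.\<close>

definition near_rational_prod :: "real \<Rightarrow> real \<Rightarrow> nat \<Rightarrow> (real^'n^'n) set" where
  "near_rational_prod m d n = near_rational (m ^ (n + 1)) (m ^ (2 * n + 2) * d)"

text \<open>The three error terms of a product are at most \<open>m\<close>, 1 and 1 times
  \<open>m ^ (2 * n + 2) * d\<close>, and \<open>m + 2 \<le> m * m\<close> once
  \<open>m \<ge> 2\<close>.\<close>

lemma near_rational_prod_aux:
  fixes m d :: real
  assumes "m \<ge> 2" "0 < d" "d \<le> 1"
  shows "m ^ (2 * n + 2) * d * m + m ^ (n + 1) * d + m ^ (2 * n + 2) * d * d \<le> m ^ (2 * Suc n + 2) * d"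
proof -
  have "m ^ (n + 1) * d \<le> m ^ (2 * n + 2) * d"
    using assms by (intro mult_right_mono power_increasing) auto
  moreover have "m ^ (2 * n + 2) * d * d \<le> m ^ (2 * n + 2) * d * 1"
    using assms by (intro mult_left_mono) auto
  moreover have "m ^ (2 * n + 2) * d * (m + 2) \<le> m ^ (2 * n + 2) * d * (m * m)"
  proof (intro mult_left_mono)
    have "(m - 2) * (m + 1) \<ge> 0"
      using assms by simp
    then show "m + 2 \<le> m * m"
      by (simp add: algebra_simps)
  qed (use assms in auto)
  moreover have "m ^ (2 * Suc n + 2) * d = m ^ (2 * n + 2) * d * (m * m)"
    by (simp add: power_add)
  ultimately show ?thesis
    unfolding distrib_left mult_1_right by linarith
qed

lemma near_rational_prod_mult_right:
  assumes "g \<in> near_rational_prod m d n" "a \<in> near_rational m d" "m \<ge> 2" "0 < d" "d \<le> 1"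
  shows "g ** a \<in> near_rational_prod m d (Suc n)"
proof -
  have "g ** a \<in> near_rational (m ^ (n + 1) * m)
      (m ^ (2 * n + 2) * d * m + m ^ (n + 1) * d + m ^ (2 * n + 2) * d * d)"
    using assms unfolding near_rational_prod_def by (intro near_rational_mult) auto
  then have "g ** a \<in> near_rational (m ^ (n + 1) * m) (m ^ (2 * Suc n + 2) * d)"
    by (rule near_rational_mono) (rule near_rational_prod_aux[OF assms(3-5)])
  then show ?thesis
    by (simp add: near_rational_prod_def mult_ac)
qed

lemma near_rational_prod_mult_left:
  assumes "g \<in> near_rational_prod m d n" "a \<in> near_rational m d" "m \<ge> 2" "0 < d" "d \<le> 1"
  shows "a ** g \<in> near_rational_prod m d (Suc n)"
proof -
  have "a ** g \<in> near_rational (m * m ^ (n + 1))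
      (d * m ^ (n + 1) + m * (m ^ (2 * n + 2) * d) + d * (m ^ (2 * n + 2) * d))"
    using assms unfolding near_rational_prod_def by (intro near_rational_mult) auto
  then have "a ** g \<in> near_rational (m * m ^ (n + 1)) (m ^ (2 * Suc n + 2) * d)"
    by (rule near_rational_mono) (use near_rational_prod_aux[OF assms(3-5), of n] in \<open>simp add: mult_ac add_ac\<close>)
  then show ?thesis
    by (simp add: near_rational_prod_def mult_ac)
qed

lemma near_rational_prod_mono:
  assumes "g \<in> near_rational_prod m d n" "n \<le> n'" "m \<ge> 2" "0 < d" "m \<in> \<int>"
  shows "g \<in> near_rational_prod m d n'"
proof -
  have "g \<in> near_rational (m ^ (n' - n) * m ^ (n + 1)) (m ^ (2 * n + 2) * d)"
    using assms unfolding near_rational_prod_def by (intro near_rational_scale) auto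
  moreover have "m ^ (n' - n) * m ^ (n + 1) = m ^ (n' + 1)"
    using assms(2) by (simp flip: power_add)
  moreover have "m ^ (2 * n + 2) * d \<le> m ^ (2 * n' + 2) * d"
    using assms by (intro mult_right_mono power_increasing) auto
  ultimately show ?thesis
    unfolding near_rational_prod_def using near_rational_mono by metis
qed

lemma prefix_prod_near_rational:
  assumes "\<And>i. i < n \<Longrightarrow> \<gamma> i \<in> near_rational m d" "m \<ge> 2" "0 < d" "d \<le> 1" "m \<in> \<int>"
    and "norm (mat 1 :: real^'n^'n) \<le> m"
  shows "prefix_prod \<gamma> n \<in> (near_rational_prod m d n :: (real^'n^'n) set)"
  using assms(1)
proof (induction n)
  case 0
  have "int_height m (mat 1 :: real^'n^'n) (mat 1)"
    using assms by (simp add: int_height_def) (simp add: mat_def)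
  moreover have "matrix_inv (mat 1 :: real^'n^'n) = mat 1"
    by (rule matrix_inv_eqI) simp
  ultimately show ?case
    using assms by (auto simp: near_rational_prod_def near_rational_def intro!: exI[of _ "mat 1"])
next
  case (Suc n)
  have "prefix_prod \<gamma> n ** \<gamma> n \<in> near_rational_prod m d (Suc n)"
    using Suc by (intro near_rational_prod_mult_right assms(2-4)) auto
  then show ?case
    by simp
qed

lemma prefix_prod_split:
  "k < n \<Longrightarrow> prefix_prod \<gamma> n = prefix_prod \<gamma> k ** \<gamma> k ** prefix_prod (\<lambda>i. \<gamma> (i + Suc k)) (n - Suc k)"
proof (induction n)
  case (Suc n)
  show ?case
  proof (cases "k = n")
    case False
    with Suc.prems have "k < n" by simp
    moreover from this have "Suc n - Suc k = Suc (n - Suc k)" "n - Suc k + Suc k = n"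
      by auto
    ultimately show ?thesis
      using Suc.IH by (simp add: matrix_mul_assoc del: diff_Suc_Suc)
  qed simp
qed simp

text \<open>The lattice of \<open>G\<close> contains a vector very close to \<open>M\<close> times the \<open>i\<close>-th basis vector, the
  direction contracted by \<open>D\<close>.\<close>

lemma short_vector:
  fixes P D G :: "real^'n^'n"
  assumes P: "P \<in> near_rational M e" and G: "G \<in> near_rational M e"
    and D: "D *v axis i 1 = (1 / b) *s axis i 1" "norm D \<le> C * b"
    and "M \<in> \<int>" "M \<ge> 1" "b > 0" "C \<ge> 0"
  shows "\<exists>z. int_vec z \<and> z \<noteq> 0 \<and> norm ((P ** D ** G) *v z) \<le> (M + e) * (M / b + C * b * M\<^sup>2 * e)"
proof -
  obtain h h' where h: "int_height M h h'" "norm (G - h) < e"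
    using G by (auto simp: near_rational_def)
  obtain k where k: "norm k \<le> M" "norm (P - k) < e"
    using P by (auto simp: near_rational_def int_height_def)
  have "e > 0"
    using h(2) norm_ge_zero le_less_trans by blast
  have nP: "norm P \<le> M + e"
    using norm_triangle_sub[of P k] k by linarith
  define a :: "real^'n" where "a = axis i 1"
  have na: "norm a = 1"
    by (simp add: a_def)
  \<comment> \<open>Since \<open>h'\<close> inverts \<open>h\<close>, this vector is sent by
    \<open>h\<close> to \<open>M\<close> times the contracted axis; the factor \<open>M\<close>
    clears the denominators of \<open>h'\<close>.\<close>
  define z where "z = M *s (h' *v a)"
  have "int_vec z"
    using h(1) by (auto simp: int_vec_def z_def a_def int_height_def matrix_vector_mult_basis column_def)
  have hz: "h *v z = M *s a"
    using h(1) by (simp add: z_def int_height_def matrix_vector_mult_scaleR matrix_vector_mul_assoc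
        scalar_mult_eq_scaleR)
  then have "z \<noteq> 0"
    using \<open>M \<ge> 1\<close> by (auto simp: a_def axis_eq_0_iff)
  have "norm z \<le> M * norm (h' *v a)"
    using \<open>M \<ge> 1\<close> by (simp add: z_def scalar_mult_eq_scaleR)
  also have "\<dots> \<le> M * (norm h' * norm a)"
    using \<open>M \<ge> 1\<close> by (intro mult_left_mono norm_matrix_vector_mult_le) auto
  also have "\<dots> \<le> M * M"
    using \<open>M \<ge> 1\<close> na h by (auto simp: int_height_def)
  finally have nz: "norm z \<le> M\<^sup>2"
    by (simp add: power2_eq_square)
  \<comment> \<open>The main part meets the contraction of \<open>D\<close>; the large norm of
    \<open>D\<close> acts only on the tiny error from \<open>G - h\<close>.\<close>
  have "G *v z = M *s a + (G - h) *v z"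
    using hz by (simp add: matrix_vector_mult_diff_rdistrib)
  then have "D *v (G *v z) = (M / b) *s a + D *v ((G - h) *v z)"
    using D(1) by (simp add: matrix_vector_right_distrib a_def scalar_mult_eq_scaleR matrix_vector_mult_scaleR)
  then have "norm (D *v (G *v z)) \<le> norm ((M / b) *s a) + norm (D *v ((G - h) *v z))"
    by (simp add: norm_triangle_ineq)
  also have "norm ((M / b) *s a) = M / b"
    using na assms by (simp add: scalar_mult_eq_scaleR)
  also have "norm (D *v ((G - h) *v z)) \<le> norm D * (norm (G - h) * norm z)"
    by (meson norm_matrix_vector_mult_le order_trans mult_left_mono norm_ge_zero)
  also have "\<dots> \<le> (C * b) * (e * M\<^sup>2)"
    using D h nz assms \<open>e > 0\<close> by (intro mult_mono) auto
  finally have nDG: "norm (D *v (G *v z)) \<le> M / b + C * b * M\<^sup>2 * e"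
    by (simp add: mult_ac)
  have "norm ((P ** D ** G) *v z) \<le> norm P * norm (D *v (G *v z))"
    using norm_matrix_vector_mult_le[of P] by (simp flip: matrix_vector_mul_assoc)
  also have "\<dots> \<le> (M + e) * (M / b + C * b * M\<^sup>2 * e)"
    using nP nDG assms \<open>e > 0\<close> by (intro mult_mono) auto
  finally show ?thesis
    using \<open>int_vec z\<close> \<open>z \<noteq> 0\<close> by blast
qed

section \<open>Liouville numbers and levels\<close>

text \<open>With \<open>R = denom c j\<close> and \<open>m = R\<^sup>2\<close>, a product of at most \<open>j + 2\<close> factors of lower level has
  size and denominator at most \<open>M = m ^ (j + 2) = R ^ (2 * j + 4)\<close>. The factor of level \<open>j\<close> stretches by
  \<open>M ^ 3\<close>, and lower levels are rational up to \<open>1 / M ^ 9\<close>: this makes the bound of the lemma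
  \<open>short_vector\<close> of order \<open>1 / M\<close>. The growth of \<open>denom\<close> leaves room for these powers.\<close>

primrec denom :: "nat \<Rightarrow> nat \<Rightarrow> nat" where
  "denom c 0 = c"
| "denom c (Suc j) = (j + 2) * 2 ^ (j + 1) * denom c j ^ (20 * j + 40)"

definition denom_tol :: "nat \<Rightarrow> nat \<Rightarrow> real" where
  "denom_tol c j = 1 / real (denom c j) ^ (18 * j + 36)"

lemma denom_pos: "c > 0 \<Longrightarrow> denom c j > 0"
  by (induction j) auto

lemma denom_dvd_Suc: "denom c j dvd denom c (Suc j)"
  by (simp add: dvd_mult dvd_power)

lemma denom_dvd: "i \<le> j \<Longrightarrow> denom c i dvd denom c j"
  by (induction rule: dec_induct) (auto intro: dvd_trans[OF _ denom_dvd_Suc] simp del: denom.simps)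

lemma denom_mono: "c > 0 \<Longrightarrow> i \<le> j \<Longrightarrow> denom c i \<le> denom c j"
  using denom_dvd denom_pos dvd_imp_le by metis

lemma denom_ge: "c > 0 \<Longrightarrow> c \<le> denom c j"
  using denom_mono[of c 0 j] by simp

text \<open>The factor \<open>j + 2\<close> of the recursion runs through all integers from 2 on,
  with \<open>d\<close> entering at index \<open>d - 1\<close>. Hence every rational number
  eventually has its denominator cleared.\<close>

lemma dvd_denom:
  assumes "0 < d" "d \<le> j"
  shows "d dvd denom c j"
proof (cases "d = 1")
  case False
  with assms(1) have d: "d - 2 + 2 = d" by simp
  have "d - 2 + 2 dvd denom c (Suc (d - 2))"
    unfolding denom.simps by (intro dvd_mult2 dvd_refl)
  then have "d dvd denom c (Suc (d - 2))"
    unfolding d .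
  moreover have "Suc (d - 2) \<le> j"
    using assms False by simp
  ultimately show ?thesis
    using denom_dvd dvd_trans by blast
qed simp

lemma denom_ge_index: "c > 0 \<Longrightarrow> j \<le> denom c j"
  using dvd_denom[of j j c] denom_pos[of c j] dvd_imp_le by (cases "j = 0") auto

text \<open>In a Liouville series the factor \<open>l\<close> absorbs the numerator,
  \<open>2 ^ l\<close> leaves a geometric series, and the power of \<open>denom c i\<close> is the
  quality of approximation. Its exponent exceeds that of \<open>denom_tol\<close> by 2.\<close>

lemma denom_growth:
  assumes "c > 0" "i < l"
  shows "real l * 2 ^ l * real (denom c i) ^ (18 * i + 38) \<le> real (denom c l)"
proof -
  obtain j where l: "l = Suc j" and "i \<le> j"
    using assms(2) by (metis less_Suc_eq_le lessE)
  have "denom c i ^ (18 * i + 38) \<le> denom c j ^ (18 * i + 38)"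
    using denom_mono[OF assms(1) \<open>i \<le> j\<close>] by (rule power_mono) simp
  also have "\<dots> \<le> denom c j ^ (20 * j + 40)"
    using \<open>i \<le> j\<close> denom_pos[OF assms(1), of j] by (intro power_increasing) auto
  finally have "l * 2 ^ l * denom c i ^ (18 * i + 38) \<le> (j + 2) * 2 ^ (j + 1) * denom c j ^ (20 * j + 40)"
    unfolding l by (intro mult_mono) auto
  then have "l * 2 ^ l * denom c i ^ (18 * i + 38) \<le> denom c l"
    by (simp add: l)
  then have "real (l * 2 ^ l * denom c i ^ (18 * i + 38)) \<le> real (denom c l)"
    using of_nat_le_iff by blast
  then show ?thesis
    by simp
qed

text \<open>Unlike a series with binary digits of \<open>x\<close>, this one is visibly strictly increasing in \<open>x\<close>.\<close>

definition liouville_term :: "nat \<Rightarrow> real \<Rightarrow> nat \<Rightarrow> real" where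
  "liouville_term c x l = real_of_int \<lfloor>real l * x\<rfloor> / real (denom c l)"

definition liouville :: "nat \<Rightarrow> real \<Rightarrow> real" where
  "liouville c x = (\<Sum>l. liouville_term c x l)"

lemma liouville_term_nonneg: "0 \<le> x \<Longrightarrow> 0 \<le> liouville_term c x l"
  by (simp add: liouville_term_def)

lemma liouville_term_le:
  assumes "c > 0" "0 < x" "i < l"
  shows "liouville_term c x l \<le> x * (1 / 2) ^ l / real (denom c i) ^ (18 * i + 38)"
proof -
  have pos: "real (denom c l) > 0" "real (denom c i) ^ (18 * i + 38) > 0"
    using denom_pos[OF assms(1)] by auto
  have "liouville_term c x l \<le> real l * x / real (denom c l)"
    unfolding liouville_term_def using pos by (intro divide_right_mono) auto
  also have "\<dots> \<le> real l * x / (real l * 2 ^ l * real (denom c i) ^ (18 * i + 38))"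
    using denom_growth[OF assms(1,3)] assms pos by (intro divide_left_mono mult_pos_pos) auto
  also have "\<dots> = x * (1 / 2) ^ l / real (denom c i) ^ (18 * i + 38)"
    using assms(3) by (simp add: field_simps)
  finally show ?thesis .
qed

lemma liouville_term_le_geometric:
  assumes "c > 0" "0 < x"
  shows "liouville_term c x l \<le> x * (1 / 2) ^ l"
proof (cases "l = 0")
  case False
  have "liouville_term c x l \<le> x * (1 / 2) ^ l / real (denom c 0) ^ (18 * 0 + 38)"
    using False assms by (intro liouville_term_le) auto
  also have "\<dots> \<le> x * (1 / 2) ^ l / 1"
    using assms by (intro divide_left_mono one_le_power) auto
  finally show ?thesis by simp
qed (use assms in \<open>simp add: liouville_term_def\<close>)

lemma summable_liouville_term:
  assumes "c > 0" "0 < x"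
  shows "summable (liouville_term c x)"
proof (rule summable_comparison_test)
  show "summable (\<lambda>l. x * (1 / 2) ^ l)"
    by (intro summable_mult summable_geometric) auto
  show "\<exists>N. \<forall>n\<ge>N. norm (liouville_term c x n) \<le> x * (1 / 2) ^ n"
    using liouville_term_le_geometric[OF assms] liouville_term_nonneg[of x] assms by auto
qed

lemma liouville_nonneg: "c > 0 \<Longrightarrow> 0 < x \<Longrightarrow> 0 \<le> liouville c x"
  unfolding liouville_def by (intro suminf_nonneg summable_liouville_term liouville_term_nonneg) auto

text \<open>A bound linear in \<open>x\<close> makes small parameters give shears close to the
  identity, on which full support relies.\<close>

lemma liouville_le:
  assumes "c > 0" "0 < x"
  shows "liouville c x \<le> 2 * x"
proof -
  have "liouville c x \<le> (\<Sum>l. x * (1 / 2) ^ l)"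
    unfolding liouville_def using assms
    by (intro suminf_le liouville_term_le_geometric summable_liouville_term summable_mult summable_geometric) auto
  also have "\<dots> = 2 * x"
    by (subst suminf_mult) (auto simp: suminf_geometric intro: summable_geometric)
  finally show ?thesis .
qed

text \<open>Every term is weakly increasing in \<open>x\<close>, and as soon as
  \<open>l * (y - x) > 1\<close> the floors differ. The resulting injectivity yields both the
  absence of atoms and uncountably many points.\<close>

lemma liouville_strict_mono:
  assumes "c > 0" "0 < x" "x < y"
  shows "liouville c x < liouville c y"
proof -
  have sx: "summable (liouville_term c x)" and sy: "summable (liouville_term c y)"
    using assms by (auto intro: summable_liouville_term)
  have pos: "real (denom c l) > 0" for l
    using denom_pos[OF assms(1)] by auto
  obtain l where "1 / (y - x) < real l"
    using reals_Archimedean2 by blast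
  then have "real l * x + 1 < real l * y"
    using assms by (simp add: field_simps)
  then have "\<lfloor>real l * x\<rfloor> < \<lfloor>real l * y\<rfloor>"
    by linarith
  then have "liouville_term c x l < liouville_term c y l"
    unfolding liouville_term_def using pos by (simp add: divide_strict_right_mono)
  moreover have "liouville_term c x k \<le> liouville_term c y k" for k
    unfolding liouville_term_def using pos[of k] assms
    by (intro divide_right_mono of_int_le_iff[THEN iffD2] floor_mono mult_left_mono) auto
  ultimately have "0 < (\<Sum>k. liouville_term c y k - liouville_term c x k)"
    by (intro suminf_pos2[of _ l] summable_diff sx sy) auto
  then show ?thesis
    using suminf_diff[OF sy sx] by (simp add: liouville_def)
qed

definition liouville_trunc :: "nat \<Rightarrow> nat \<Rightarrow> real \<Rightarrow> real" where
  "liouville_trunc c i x = (\<Sum>l<Suc i. liouville_term c x l)"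

text \<open>All denominators up to index \<open>i\<close> divide \<open>denom c i\<close>. For
  \<open>c = 0\<close> they vanish and the quotients are 0 by convention.\<close>

lemma liouville_trunc_Ints: "real (denom c i) * liouville_trunc c i x \<in> \<int>"
proof -
  have "real (denom c i) * liouville_term c x l \<in> \<int>" if l: "l < Suc i" for l
  proof -
    obtain k where k: "denom c i = denom c l * k"
      using denom_dvd[of l i c] l by (auto elim: dvdE)
    have "real (denom c i) * liouville_term c x l =
        (if denom c l = 0 then 0 else real k * real_of_int \<lfloor>real l * x\<rfloor>)"
      by (simp add: liouville_term_def k)
    then show ?thesis
      by simp
  qed
  then show ?thesis
    unfolding liouville_trunc_def sum_distrib_left by (intro Ints_sum) auto
qed

text \<open>The terms beyond \<open>i\<close> are dominated by a geometric series of total mass 1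
  times the stated error: the truncation is a rational number of denominator
  \<open>denom c i\<close> approximating to a power that grows with \<open>i\<close>.\<close>

lemma liouville_trunc_bounds:
  assumes "c > 0" "0 < x" "x \<le> 1"
  shows "0 \<le> liouville_trunc c i x" "liouville_trunc c i x \<le> liouville c x"
    "liouville c x \<le> liouville_trunc c i x + 1 / real (denom c i) ^ (18 * i + 38)"
proof -
  have s: "summable (liouville_term c x)"
    using assms by (auto intro: summable_liouville_term)
  show "0 \<le> liouville_trunc c i x"
    unfolding liouville_trunc_def using assms by (intro sum_nonneg liouville_term_nonneg) auto
  have split: "liouville c x = (\<Sum>l. liouville_term c x (l + Suc i)) + liouville_trunc c i x"
    unfolding liouville_def liouville_trunc_def using suminf_split_initial_segment[OF s] by blast
  have s': "summable (\<lambda>l. liouville_term c x (l + Suc i))"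
    using s by (rule summable_ignore_initial_segment)
  have "0 \<le> (\<Sum>l. liouville_term c x (l + Suc i))"
    using assms by (intro suminf_nonneg s' liouville_term_nonneg) auto
  then show "liouville_trunc c i x \<le> liouville c x"
    using split by simp
  define B where "B = 1 / real (denom c i) ^ (18 * i + 38)"
  have "B \<ge> 0" by (simp add: B_def)
  have "liouville_term c x (l + Suc i) \<le> B * (1 / 2) ^ Suc l" for l
  proof -
    have "liouville_term c x (l + Suc i) \<le> x * (1 / 2) ^ (l + Suc i) * B"
      using liouville_term_le[of c x i "l + Suc i"] assms by (simp add: B_def)
    also have "\<dots> \<le> 1 * (1 / 2) ^ Suc l * B"
      using assms \<open>B \<ge> 0\<close> by (intro mult_mono power_decreasing) auto
    finally show ?thesis by (simp add: mult_ac)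
  qed
  moreover have "(\<lambda>l. B * (1 / 2) ^ Suc l) sums (B * 1)"
    by (intro sums_mult power_half_series)
  ultimately have "(\<Sum>l. liouville_term c x (l + Suc i)) \<le> B"
    using s' suminf_le[of "\<lambda>l. liouville_term c x (l + Suc i)" "\<lambda>l. B * (1 / 2) ^ Suc l"]
    by (simp add: sums_iff)
  then show "liouville c x \<le> liouville_trunc c i x + 1 / real (denom c i) ^ (18 * i + 38)"
    using split by (simp add: B_def)
qed

text \<open>The term at index 0 vanishes, so truncating there leaves only the error. Values in [0,
  1) stay distinct modulo the integers, which separates the corresponding lattices.\<close>

lemma liouville_less_1:
  assumes "c > 1" "0 < x" "x \<le> 1"
  shows "liouville c x < 1"
proof -
  have "liouville c x \<le> 1 / real c ^ 38"
    using liouville_trunc_bounds(3)[of c x 0] assms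
    by (simp add: liouville_trunc_def liouville_term_def)
  also have "\<dots> < 1"
    using assms by (simp add: one_less_power)
  finally show ?thesis .
qed

section \<open>Shears, diagonal matrices and their heights\<close>

lemma norm_matrix_le_card:
  fixes A :: "real^'n^'m"
  assumes "\<And>i. norm (A $ i) \<le> B"
  shows "norm A \<le> real CARD('m) * B"
proof -
  have "norm A \<le> (\<Sum>i\<in>UNIV. norm (A $ i))"
    unfolding norm_vec_def[of A] by (rule L2_set_le_sum) simp
  also have "\<dots> \<le> real CARD('m) * B"
    using assms by (intro sum_bounded_above)
  finally show ?thesis .
qed

lemma norm_mat_1_le: "norm (mat 1 :: real^'n^'n) \<le> real CARD('n)"
proof -
  have "(mat 1 :: real^'n^'n) $ i = axis i 1" for i
    by (simp add: mat_def axis_def vec_eq_iff)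
  then show ?thesis
    using norm_matrix_le_card[of "mat 1 :: real^'n^'n" 1] by simp
qed

definition shear :: "'n::finite \<Rightarrow> 'n \<Rightarrow> real \<Rightarrow> real^'n^'n" where
  "shear p q t = mat 1 + t *\<^sub>R axis p (axis q 1)"

lemma shear_nth: "shear p q t $ i $ j = (if i = j then 1 else 0) + (if i = p \<and> j = q then t else 0)"
  by (simp add: shear_def mat_def axis_def)

text \<open>The matrix unit at \<open>(p, q)\<close> squares to 0, so shears form an additive
  one-parameter group.\<close>

lemma shear_mult:
  fixes p q :: "'n::finite"
  assumes "p \<noteq> q"
  shows "shear p q s ** shear p q t = shear p q (s + t)"
proof -
  have "axis p (axis q 1) ** axis p (axis q (1 :: real)) = (0 :: real^'n^'n)" if "p \<noteq> q" for p q :: 'n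
    using that by (auto simp: vec_eq_iff matrix_matrix_mult_def axis_def intro!: sum.neutral)
  then show ?thesis
    using assms by (simp add: shear_def scaleR_left_distrib
        bounded_bilinear.add_left[OF bounded_bilinear_matrix_mult]
        bounded_bilinear.add_right[OF bounded_bilinear_matrix_mult]
        bounded_bilinear.scaleR_left[OF bounded_bilinear_matrix_mult]
        bounded_bilinear.scaleR_right[OF bounded_bilinear_matrix_mult])
qed

lemma shear_0: "shear p q 0 = mat 1"
  by (simp add: shear_def)

lemma shear_mult_minus: "p \<noteq> q \<Longrightarrow> shear p q t ** shear p q (- t) = mat 1"
  by (simp add: shear_mult shear_0)

lemma det_shear:
  assumes "p \<noteq> q"
  shows "det (shear p q t) = 1"
proof -
  have "shear p q t = (\<chi> k. if k = p then row p (mat 1) + t *s row q (mat 1) else row k (mat 1))"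
    by (auto simp: vec_eq_iff shear_nth row_def mat_def)
  then show ?thesis
    using det_row_operation[OF assms, of "mat 1" t] by simp
qed

lemma shear_diff: "shear p q s - shear p q t = (s - t) *\<^sub>R axis p (axis q 1)"
  by (simp add: shear_def scaleR_left_diff_distrib)

lemma norm_shear_diff: "norm (shear p q s - shear p q t) = \<bar>s - t\<bar>"
  by (simp add: shear_diff)

text \<open>The lower bound on \<open>K\<close> accounts for the norm of the identity plus that of
  \<open>t\<close> times a matrix unit; for its sake \<open>denom\<close> starts above the
  dimension.\<close>

lemma int_height_shear:
  fixes p q :: "'n::finite"
  assumes "p \<noteq> q" "K \<in> \<int>" "K * t \<in> \<int>" "\<bar>t\<bar> \<le> 1" "real CARD('n) + 1 \<le> K"
  shows "int_height K (shear p q t) (shear p q (- t))"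
proof -
  have norm: "norm (shear p q s) \<le> K" if "\<bar>s\<bar> \<le> 1" for s
  proof -
    have "norm (shear p q s) \<le> norm (mat 1 :: real^'n^'n) + \<bar>s\<bar>"
      using norm_triangle_ineq[of "mat 1" "s *\<^sub>R axis p (axis q (1 :: real))"] by (simp add: shear_def)
    then show ?thesis
      using norm_mat_1_le[where 'n='n] that assms(5) by linarith
  qed
  have "K * shear p q s $ i $ j \<in> \<int>" if "K * s \<in> \<int>" for s i j
    using that assms(2) by (simp add: shear_nth distrib_left)
  moreover have "K * - t \<in> \<int>"
    using assms(3) by simp
  ultimately show ?thesis
    using assms norm[of t] norm[of "- t"] shear_mult_minus[OF assms(1)] unfolding int_height_def by auto
qed

definition two_diag :: "'n::finite \<Rightarrow> 'n \<Rightarrow> real \<Rightarrow> real^'n^'n" where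
  "two_diag p q b = (\<chi> i j. if i = j then if i = p then b else if i = q then 1 / b else 1 else 0)"

lemma two_diag_mult_inverse:
  assumes "b > 0"
  shows "two_diag p q b ** two_diag p q (1 / b) = mat 1"
proof -
  have "two_diag p q b $ i $ k * two_diag p q (1 / b) $ k $ j = (if k = i then mat 1 $ i $ j else 0)" for i j k
    using assms by (simp add: two_diag_def mat_def)
  then show ?thesis
    by (simp add: vec_eq_iff matrix_matrix_mult_def)
qed

lemma det_two_diag:
  assumes "b > 0" "p \<noteq> q"
  shows "det (two_diag p q b) = 1"
proof -
  let ?f = "\<lambda>i. if i = p then b else if i = q then 1 / b else 1"
  have "det (two_diag p q b) = (\<Prod>i\<in>UNIV. ?f i)"
    by (subst det_diagonal) (auto simp: two_diag_def)
  also have "\<dots> = ?f p * (?f q * (\<Prod>i\<in>UNIV - {p} - {q}. ?f i))"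
    using assms by (subst prod.remove[of _ p], simp, simp, subst prod.remove[of _ q]) auto
  also have "(\<Prod>i\<in>UNIV - {p} - {q}. ?f i) = 1"
    by (intro prod.neutral) auto
  finally show ?thesis
    using assms by simp
qed

lemma two_diag_axis:
  assumes "b > 0" "p \<noteq> q"
  shows "two_diag p q b *v axis q 1 = (1 / b) *s axis q 1"
    and "two_diag p q (1 / b) *v axis p 1 = (1 / b) *s axis p 1"
  using assms unfolding matrix_vector_mult_basis
  by (auto simp: column_def two_diag_def vec_eq_iff axis_def)

lemma norm_two_diag:
  fixes p q :: "'n::finite"
  assumes "b \<ge> 1"
  shows "norm (two_diag p q b) \<le> real CARD('n) * b" "norm (two_diag p q (1 / b)) \<le> real CARD('n) * b"
proof -
  have *: "norm (two_diag p q a $ i) \<le> b" if "0 < a" "a \<le> b" "1 / a \<le> b" for a i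
  proof -
    have "two_diag p q a $ i = (if i = p then a else if i = q then 1 / a else 1) *\<^sub>R axis i 1"
      by (auto simp: two_diag_def axis_def vec_eq_iff)
    then show ?thesis
      using that assms by simp
  qed
  have "1 / b \<le> b"
    using assms by (simp add: divide_le_eq) (smt (verit) mult_le_cancel_left1)
  then show "norm (two_diag p q b) \<le> real CARD('n) * b" "norm (two_diag p q (1 / b)) \<le> real CARD('n) * b"
    using assms by (intro norm_matrix_le_card *; simp)+
qed

lemma int_height_two_diag:
  fixes p q :: "'n::finite"
  assumes "b > 0" "b dvd K" "CARD('n) * b \<le> K"
  shows "int_height (real K) (two_diag p q (real b)) (two_diag p q (1 / real b))"
proof -
  obtain k where k: "K = b * k"
    using assms(2) by (auto elim: dvdE)
  have "norm (two_diag p q (real b)) \<le> real CARD('n) * real b"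
    "norm (two_diag p q (1 / real b)) \<le> real CARD('n) * real b"
    using norm_two_diag[of "real b"] assms(1) by auto
  moreover have "real CARD('n) * real b \<le> real K"
    using assms(3) by (metis of_nat_le_iff of_nat_mult)
  moreover have "real K * two_diag p q (real b) $ i $ j \<in> \<int>" "real K * two_diag p q (1 / real b) $ i $ j \<in> \<int>" for i j
    using assms(1) by (auto simp: two_diag_def k)
  ultimately show ?thesis
    using two_diag_mult_inverse[of "real b"] assms(1) by (auto simp: int_height_def)
qed

text \<open>The approximating matrix uses the truncated Liouville number. Its height is squared: one
  factor for \<open>e\<close>, one for the truncated shear.\<close>

lemma near_rational_liouville:
  fixes p q :: "'n::finite"
  assumes "p \<noteq> q" "CARD('n) < c" "0 < x" "x \<le> 1"
    and e: "int_height (real (denom c i)) e e'" "det e = 1"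
  shows "e ** shear p q (liouville c x) \<in> near_rational (real (denom c i) ^ 2) (denom_tol c i)"
proof -
  define R where "R = real (denom c i)"
  define t where "t = liouville c x"
  define s where "s = liouville_trunc c i x"
  have "c > 1" "c > 0"
    using assms(2) zero_less_card_finite[where 'a='n] by linarith+
  have "c \<le> denom c i"
    using denom_ge \<open>c > 0\<close> by blast
  then have R: "R \<ge> real CARD('n) + 1" "R > 1"
    using assms(2) \<open>c > 1\<close> unfolding R_def by linarith+
  have s: "0 \<le> s" "s \<le> t" "t \<le> s + 1 / R ^ (18 * i + 38)" "t < 1"
    using liouville_trunc_bounds[of c x i] liouville_less_1[of c x] assms \<open>c > 1\<close>
    by (auto simp: s_def t_def R_def)
  \<comment> \<open>Of the two spare powers of \<open>R\<close> in the truncation error, one pays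
    for the norm of \<open>e\<close> and the other gives strictness.\<close>
  have tol: "R * \<bar>t - s\<bar> < denom_tol c i"
  proof -
    have "R * \<bar>t - s\<bar> \<le> R * (1 / R ^ (18 * i + 38))"
      using s R by (intro mult_left_mono) auto
    also have "\<dots> = 1 / R ^ (18 * i + 37)"
      using R by (simp add: field_simps power_add eval_nat_numeral)
    also have "\<dots> < 1 / R ^ (18 * i + 36)"
      using R by (intro divide_strict_left_mono power_strict_increasing) auto
    finally show ?thesis
      by (simp add: denom_tol_def R_def)
  qed
  have "int_height R (shear p q s) (shear p q (- s))"
    using assms(1) R s liouville_trunc_Ints[of c i x] by (intro int_height_shear) (auto simp: R_def s_def)
  then have h: "int_height (R * R) (e ** shear p q s) (shear p q (- s) ** e')"
    using e(1) int_height_mult by (simp add: R_def)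
  have "e ** shear p q t - e ** shear p q s = e ** (shear p q t - shear p q s)"
    by (simp add: bounded_bilinear.diff_right[OF bounded_bilinear_matrix_mult])
  then have "norm (e ** shear p q t - e ** shear p q s) \<le> norm e * \<bar>t - s\<bar>"
    using norm_matrix_mult_le[of e "shear p q t - shear p q s"] by (simp add: norm_shear_diff)
  also have "\<dots> \<le> R * \<bar>t - s\<bar>"
    using e(1) by (intro mult_right_mono) (auto simp: int_height_def R_def)
  finally have 1: "norm (e ** shear p q t - e ** shear p q s) < denom_tol c i"
    using tol by simp
  have inv: "matrix_inv (e ** shear p q t) = shear p q (- t) ** e'"
    using e matrix_inv_eqI[of e e'] matrix_inv_eqI[OF shear_mult_minus[OF assms(1)], of t]
    by (simp add: matrix_inv_mult det_shear[OF assms(1)] int_height_def)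
  have "shear p q (- t) ** e' - shear p q (- s) ** e' = (shear p q (- t) - shear p q (- s)) ** e'"
    by (simp add: bounded_bilinear.diff_left[OF bounded_bilinear_matrix_mult])
  then have "norm (shear p q (- t) ** e' - shear p q (- s) ** e') \<le> \<bar>t - s\<bar> * norm e'"
    using norm_matrix_mult_le[of "shear p q (- t) - shear p q (- s)" e'] by (simp add: norm_shear_diff abs_minus_commute)
  also have "\<dots> \<le> \<bar>t - s\<bar> * R"
    using e(1) by (intro mult_left_mono) (auto simp: int_height_def R_def)
  finally have 2: "norm (matrix_inv (e ** shear p q t) - shear p q (- s) ** e') < denom_tol c i"
    using tol inv by (simp add: mult.commute)
  show ?thesis
    unfolding near_rational_def t_def[symmetric] R_def[symmetric] power2_eq_square
    using h 1 2 e(2) det_shear[OF assms(1)] by (auto simp: det_mul)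
qed

lemma int_height_denom_mono:
  assumes "int_height (real (denom c i)) h h'" "i \<le> j" "c > 0"
  shows "int_height (real (denom c j)) h h'"
proof -
  obtain k where k: "denom c j = denom c i * k"
    using denom_dvd[OF assms(2)] by (auto elim: dvdE)
  then have "k > 0"
    using denom_pos[OF assms(3), of j] by (cases k) auto
  then have "int_height (real k * real (denom c i)) h h'"
    using assms(1) by (intro int_height_scale) auto
  then show ?thesis
    by (simp add: k mult.commute)
qed

lemma Rats_denom_Ints:
  assumes "x \<in> \<rat>"
  shows "\<forall>\<^sub>F j in sequentially. real (denom c j) * x \<in> \<int>"
proof -
  obtain a b where ab: "b > 0" "x = real_of_int a / real_of_int b"
    using assms by (auto elim: Rats_cases')
  have "real (denom c j) * x \<in> \<int>" if j: "j \<ge> nat b" for j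
  proof -
    obtain k where "denom c j = nat b * k"
      using dvd_denom[of "nat b" j c] ab j by (auto elim: dvdE)
    then have "real (denom c j) * x = real k * real_of_int a"
      using ab by simp
    then show ?thesis
      by simp
  qed
  then show ?thesis
    by (auto simp: eventually_sequentially)
qed

lemma rational_int_height:
  fixes r :: "real^'n^'n"
  assumes "det r = 1" "\<forall>i j. r $ i $ j \<in> \<rat>" "c > 0"
  shows "\<forall>\<^sub>F j in sequentially. int_height (real (denom c j)) r (matrix_inv r)"
proof -
  have inv: "matrix_inv r $ i $ j \<in> \<rat>" for i j
    unfolding matrix_inv_nth[OF assms(1)] using assms(2) by (intro det_Rats) (auto simp: axis_def)
  have "\<forall>\<^sub>F k in sequentially. \<forall>i j. real (denom c k) * r $ i $ j \<in> \<int> \<and> real (denom c k) * matrix_inv r $ i $ j \<in> \<int>"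
    using assms(2) inv by (intro eventually_all_finite eventually_conj Rats_denom_Ints) auto
  moreover have "\<forall>\<^sub>F k in sequentially. a \<le> real (denom c k)" for a
  proof -
    obtain n where "a \<le> real n"
      using real_arch_simple by blast
    then have "a \<le> real (denom c k)" if "k \<ge> n" for k
      using denom_ge_index[OF assms(3), of k] that by linarith
    then show ?thesis
      by (auto simp: eventually_sequentially)
  qed
  from eventually_conj[OF this[of "norm r"] this[of "norm (matrix_inv r)"]]
  have "\<forall>\<^sub>F k in sequentially. norm r \<le> real (denom c k) \<and> norm (matrix_inv r) \<le> real (denom c k)" .
  ultimately show ?thesis
    by eventually_elim (use matrix_inv_SL[OF assms(1)] in \<open>auto simp: int_height_def\<close>)
qed

definition big_factor :: "nat \<Rightarrow> nat \<Rightarrow> real" where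
  "big_factor c j = real (denom c j) ^ (6 * j + 12)"

text \<open>The powers of two are the rare levels reserved for the dense set of rational matrices.\<close>

lemma level_matrices_exist:
  fixes p q :: "'n::finite"
  assumes "CARD('n) < c" "p \<noteq> q"
  shows "\<exists>e :: nat \<Rightarrow> real^'n^'n. (\<forall>j. det (e j) = 1 \<and> (\<exists>h'. int_height (real (denom c (Suc j))) (e j) h')) \<and>
    (\<forall>j. j \<notin> range (power 2) \<longrightarrow> e j = two_diag p q (big_factor c j)) \<and>
    (\<forall>U. open U \<and> U \<inter> {g. det g = 1} \<noteq> {} \<longrightarrow> (\<exists>j. e j \<in> U))"
proof -
  have "c > 0" using assms(1) by simp
  define Q where "Q = {r :: real^'n^'n. det r = 1 \<and> (\<forall>i j. r $ i $ j \<in> \<rat>)}"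
  obtain T where T: "countable T" "T \<subseteq> Q" "Q \<subseteq> closure T"
    using separable[of Q] by blast
  have "mat 1 \<in> Q"
    by (simp add: Q_def) (simp add: mat_def)
  then have "T \<noteq> {}"
    using T(3) by auto
  define r where "r = from_nat_into T"
  have r: "range r = T"
    unfolding r_def using range_from_nat_into[OF \<open>T \<noteq> {}\<close> T(1)] .
  define ok where "ok j g \<longleftrightarrow> int_height (real (denom c (Suc j))) g (matrix_inv g)" for j and g :: "real^'n^'n"
  \<comment> \<open>The first component of \<open>prod_decode i\<close> takes each value infinitely
    often, so every matrix of the dense set is offered at arbitrarily high levels. It is accepted
    when its height fits the level, and the identity stands in otherwise.\<close>
  define f where "f j i = (let g = r (fst (prod_decode i)) in if ok j g then g else mat 1)" for j i
  define e where "e j = (if j \<in> range (power 2) then f j (inv_into UNIV (power 2) j) else two_diag p q (big_factor c j))" for j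
  have R1: "real CARD('n) + 1 \<le> real (denom c j)" for j
    using denom_ge[OF \<open>c > 0\<close>, of j] assms(1) by linarith
  have one: "int_height (real (denom c j)) (mat 1 :: real^'n^'n) (mat 1)" for j
    using int_height_shear[OF assms(2), of "real (denom c j)" 0] R1[of j] by (simp add: shear_0)
  have f: "det (f j i) = 1 \<and> (\<exists>h'. int_height (real (denom c (Suc j))) (f j i) h')" for j i
  proof -
    have "r (fst (prod_decode i)) \<in> Q"
      using r T(2) by auto
    then show ?thesis
      using one[of "Suc j"] by (auto simp: f_def Let_def ok_def Q_def simp del: denom.simps)
  qed
  have big: "det (two_diag p q (big_factor c j)) = 1 \<and>
      (\<exists>h'. int_height (real (denom c (Suc j))) (two_diag p q (big_factor c j)) h')" for j
  proof -
    have pos: "denom c j > 0"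
      using denom_pos[OF \<open>c > 0\<close>] .
    have "CARD('n) * denom c j ^ (6 * j + 12) \<le> denom c j * denom c j ^ (6 * j + 12)"
      using R1[of j] by (intro mult_right_mono) auto
    also have "\<dots> = denom c j ^ Suc (6 * j + 12)"
      by (rule power_Suc[symmetric])
    also have "\<dots> \<le> denom c j ^ (20 * j + 40)"
      using pos by (intro power_increasing) auto
    also have "\<dots> \<le> denom c (Suc j)"
    proof -
      have "0 < (j + 2) * 2 ^ (j + 1)"
        by (intro mult_pos_pos zero_less_power) simp_all
      then have "1 * denom c j ^ (20 * j + 40) \<le> (j + 2) * 2 ^ (j + 1) * denom c j ^ (20 * j + 40)"
        by (intro mult_right_mono) linarith+
      then show ?thesis
        unfolding denom.simps by simp
    qed
    finally have "CARD('n) * denom c j ^ (6 * j + 12) \<le> denom c (Suc j)" .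
    moreover have "denom c j ^ (6 * j + 12) dvd denom c (Suc j)"
      by (auto intro!: dvd_mult le_imp_power_dvd)
    ultimately have "int_height (real (denom c (Suc j))) (two_diag p q (real (denom c j ^ (6 * j + 12))))
        (two_diag p q (1 / real (denom c j ^ (6 * j + 12))))"
      using pos by (intro int_height_two_diag) auto
    then show ?thesis
      using det_two_diag[OF _ assms(2)] pos by (auto simp: big_factor_def)
  qed
  have "\<exists>j. e j \<in> U" if U: "open U" "U \<inter> {g. det g = 1} \<noteq> {}" for U
  proof -
    obtain g where "g \<in> U" "det g = 1"
      using U(2) by auto
    then obtain g' where "g' \<in> U" "g' \<in> Q"
      using rational_SL_dense[OF \<open>det g = 1\<close> U(1) \<open>g \<in> U\<close>] unfolding Q_def by blast
    then obtain t where t: "t \<in> U" "t \<in> T"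
      using T(3) U(1) open_Int_closure_eq_empty[of U T] by blast
    then obtain a where a: "r a = t"
      using r by auto
    have "t \<in> Q"
      using t T(2) by auto
    then obtain j0 where j0: "\<And>j. j \<ge> j0 \<Longrightarrow> int_height (real (denom c j)) t (matrix_inv t)"
      using rational_int_height[of t c] \<open>c > 0\<close> by (auto simp: Q_def eventually_sequentially)
    \<comment> \<open>The second component only serves to push the level \<open>2 ^ i\<close> beyond
      \<open>j0\<close>.\<close>
    define i where "i = prod_encode (a, j0)"
    have "j0 \<le> 2 ^ i"
      using le_prod_encode_2[of j0 a] less_exp[of i] unfolding i_def by linarith
    then have "ok (2 ^ i) t"
      unfolding ok_def by (intro j0) simp
    moreover have "inv_into UNIV (power 2) ((2 :: nat) ^ i) = i"
      by (intro inv_f_f injI) simp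
    ultimately have "e (2 ^ i) = t"
      by (simp add: e_def f_def a i_def)
    then show ?thesis
      using t by blast
  qed
  then show ?thesis
    using f big by (intro exI[of _ e]) (auto simp: e_def)
qed

section \<open>Records of a slowly decaying level\<close>

lemma prod_emb_eq_Collect:
  "J \<subseteq> I \<Longrightarrow> prod_emb I M J (Pi\<^sub>E J X) = {x\<in>space (Pi\<^sub>M I M). \<forall>i\<in>J. x i \<in> X i}"
  unfolding prod_emb_def by (auto simp: space_PiM Pi_iff)

text \<open>Both measures agree on finite cylinders. This transfers almost sure statements from
  independent parameters to independent matrices.\<close>

lemma distr_PiM_map:
  assumes M: "prob_space M" and f[measurable]: "f \<in> measurable M N"
  shows "distr (\<Pi>\<^sub>M i\<in>I. M) (\<Pi>\<^sub>M i\<in>I. N) (\<lambda>\<omega>. \<lambda>i\<in>I. f (\<omega> i)) = (\<Pi>\<^sub>M i\<in>I. distr M N f)"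
    (is "distr ?M ?N ?t = ?R")
proof (rule measure_eqI_PiM_infinite[symmetric, OF refl])
  have D: "prob_space (distr M N f)"
    by (rule prob_space.prob_space_distr[OF M f])
  interpret R: prob_space ?R
    by (intro prob_space_PiM D)
  show "finite_measure ?R"
    by unfold_locales
  show sets: "sets (distr ?M ?N ?t) = sets ?R"
    unfolding sets_distr by (rule sets_PiM_cong) simp_all
  fix A J assume J: "finite J" "J \<subseteq> I" and A: "\<And>i. i \<in> J \<Longrightarrow> A i \<in> sets (distr M N f)"
  have "?R (prod_emb I (\<lambda>_. distr M N f) J (Pi\<^sub>E J A)) = (\<Prod>j\<in>J. distr M N f (A j))"
    using J A by (intro emeasure_PiM_emb D) auto
  also have "\<dots> = (\<Prod>j\<in>J. M (f -` A j \<inter> space M))"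
    using A by (intro prod.cong refl emeasure_distr f) auto
  also have "\<dots> = ?M (prod_emb I (\<lambda>_. M) J (\<Pi>\<^sub>E j\<in>J. f -` A j \<inter> space M))"
    using J A by (intro emeasure_PiM_emb[symmetric] M) (auto intro!: measurable_sets[OF f])
  also have "prod_emb I (\<lambda>_. M) J (\<Pi>\<^sub>E j\<in>J. f -` A j \<inter> space M) =
      ?t -` prod_emb I (\<lambda>_. distr M N f) J (Pi\<^sub>E J A) \<inter> space ?M"
    unfolding prod_emb_eq_Collect[OF J(2)] using J(2) measurable_space[OF f]
    by (auto simp: space_PiM PiE_iff subset_eq extensional_def)
  also have "?M \<dots> = distr ?M ?N ?t (prod_emb I (\<lambda>_. distr M N f) J (Pi\<^sub>E J A))"
  proof (rule emeasure_distr[symmetric])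
    have "prod_emb I (\<lambda>_. distr M N f) J (Pi\<^sub>E J A) \<in> sets ?R"
      using J A by (intro sets_PiM_I) auto
    then show "prod_emb I (\<lambda>_. distr M N f) J (Pi\<^sub>E J A) \<in> sets ?N"
      using sets by simp
  qed measurable
  finally show "?R (prod_emb I (\<lambda>_. distr M N f) J (Pi\<^sub>E J A)) =
      distr ?M ?N ?t (prod_emb I (\<lambda>_. distr M N f) J (Pi\<^sub>E J A))" .
qed

text \<open>The tail is so heavy that among \<open>n\<close> samples one exceeds \<open>2 ^ n\<close>, while at that height single
  values have mass at most \<open>2 powr (- n)\<close>, so that ties and powers of two are summably unlikely.\<close>

definition slow_tail :: "nat \<Rightarrow> real" where
  "slow_tail m = 1 / (1 + ln (1 + ln (1 + real m)))"

lemma slow_tail_bounds: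
  shows slow_tail_pos: "0 < slow_tail m" and slow_tail_le_1: "slow_tail m \<le> 1"
proof -
  have "0 \<le> ln (1 + real m)" by simp
  then have "0 \<le> ln (1 + ln (1 + real m))"
    by (intro ln_ge_zero) linarith
  then show "0 < slow_tail m" "slow_tail m \<le> 1"
    unfolding slow_tail_def
    by (intro divide_pos_pos divide_le_eq_1_pos[THEN iffD2]; linarith)+
qed

lemma slow_tail_strict_decreasing: "slow_tail (Suc m) < slow_tail m"
proof -
  have "0 \<le> ln (1 + real m)" "ln (1 + real m) < ln (1 + real (Suc m))"
    by simp_all
  then have "0 \<le> ln (1 + ln (1 + real m))" "ln (1 + ln (1 + real m)) < ln (1 + ln (1 + real (Suc m)))"
    by (intro ln_ge_zero ln_less_cancel_iff[THEN iffD2]; linarith)+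
  then show ?thesis
    unfolding slow_tail_def by (intro divide_strict_left_mono mult_pos_pos) linarith+
qed

text \<open>On the nonnegative reals neither \<open>ln (1 + x)\<close> nor
  \<open>1 / (1 + x)\<close> increases distances, so only the increment of the innermost logarithm
  remains.\<close>

lemma slow_tail_diff: "slow_tail m - slow_tail (Suc m) \<le> 1 / (1 + real m)"
proof -
  define a where "a = ln (1 + real m)"
  define b where "b = ln (1 + real (Suc m))"
  have ab: "0 \<le> a" "a \<le> b"
    by (simp_all add: a_def b_def)
  have "b - a \<le> (1 + real (Suc m)) / (1 + real m) - 1"
    unfolding a_def b_def using ln_le_minus_one[of "(1 + real (Suc m)) / (1 + real m)"]
    by (simp add: ln_div)
  also have "\<dots> = 1 / (1 + real m)"
    by (simp add: field_simps)
  finally have 1: "b - a \<le> 1 / (1 + real m)" .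
  define u where "u = ln (1 + a)"
  define v where "v = ln (1 + b)"
  have uv: "0 \<le> u" "u \<le> v"
    using ab by (simp_all add: u_def v_def)
  have "v - u \<le> (1 + b) / (1 + a) - 1"
    unfolding u_def v_def using ln_le_minus_one[of "(1 + b) / (1 + a)"] ab
    by (simp add: ln_div)
  also have "\<dots> = (b - a) / (1 + a)"
    using ab by (simp add: field_simps)
  also have "\<dots> \<le> b - a"
    using ab by (simp add: divide_le_eq mult_le_cancel_left1)
  finally have 2: "v - u \<le> b - a" .
  have "1 / (1 + u) - 1 / (1 + v) = (v - u) / ((1 + u) * (1 + v))"
    using uv by (simp add: field_simps)
  also have "\<dots> \<le> (v - u) / 1"
  proof (intro divide_left_mono)
    have "1 * 1 \<le> (1 + u) * (1 + v)"
      using uv by (intro mult_mono) auto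
    then show "1 \<le> (1 + u) * (1 + v)" by simp
  qed (use uv in auto)
  finally show ?thesis
    using 1 2 by (simp add: slow_tail_def a_def b_def u_def v_def)
qed

text \<open>Since \<open>slow_tail (2 ^ n)\<close> decays like \<open>1 / ln n\<close>, the terms
  are bounded by roughly \<open>exp (- n / ln n)\<close>.\<close>

lemma summable_slow_tail_power: "summable (\<lambda>n. (1 - slow_tail (2 ^ n)) ^ n)"
proof (rule summable_comparison_test_bigo)
  show "summable (\<lambda>n. norm (1 / real n ^ 2))"
    using inverse_power_summable[of 2, where 'a = real] by (simp add: field_simps)
  have "(1 - slow_tail (2 ^ n)) ^ n \<le> exp (- (real n * slow_tail (2 ^ n)))" for n
  proof -
    have "1 - slow_tail (2 ^ n) \<le> exp (- slow_tail (2 ^ n))"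
      using exp_ge_add_one_self[of "- slow_tail (2 ^ n)"] by simp
    then have "(1 - slow_tail (2 ^ n)) ^ n \<le> exp (- slow_tail (2 ^ n)) ^ n"
      using slow_tail_le_1[of "2 ^ n"] by (intro power_mono) auto
    then show ?thesis
      by (simp flip: exp_of_nat_mult)
  qed
  then have "(\<lambda>n. (1 - slow_tail (2 ^ n)) ^ n) \<in> O(\<lambda>n. exp (- (real n * slow_tail (2 ^ n))))"
    using slow_tail_le_1 by (intro bigoI[of _ 1] always_eventually allI) simp
  also have "(\<lambda>n. exp (- (real n * slow_tail (2 ^ n)))) \<in> O(\<lambda>n. 1 / real n ^ 2)"
    unfolding slow_tail_def by simp real_asymp
  finally show "(\<lambda>n. (1 - slow_tail (2 ^ n)) ^ n) \<in> O(\<lambda>n. 1 / real n ^ 2)" .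
qed

text \<open>Only the tail of the level matters for records. The locale is instantiated by a uniform
  variable, to obtain masses of levels, and by the full parameters of a step, to obtain
  records.\<close>

locale slow_level = prob_space M for M :: "'a measure" +
  fixes J :: "'a \<Rightarrow> nat"
  assumes J_measurable [measurable]: "J \<in> measurable M (count_space UNIV)"
    and prob_J: "\<And>m. prob {x\<in>space M. m \<le> J x} = slow_tail m"
begin

definition level :: "nat \<Rightarrow> 'a set" where
  "level m = {x\<in>space M. J x = m}"

lemma level_sets [measurable]: "level m \<in> sets M"
  unfolding level_def by measurable

lemma prob_level: "prob (level m) = slow_tail m - slow_tail (Suc m)"
proof -
  have "level m = {x\<in>space M. m \<le> J x} - {x\<in>space M. Suc m \<le> J x}"
    by (auto simp: level_def)
  moreover have "prob ({x\<in>space M. m \<le> J x} - {x\<in>space M. Suc m \<le> J x}) =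
      prob {x\<in>space M. m \<le> J x} - prob {x\<in>space M. Suc m \<le> J x}"
    by (intro finite_measure_Diff) auto
  ultimately show ?thesis
    by (simp add: prob_J)
qed

lemma prob_level_le: "prob (level m) \<le> 1 / (1 + real m)"
  using prob_level slow_tail_diff by simp

lemma prob_level_pos: "prob (level m) > 0"
  using prob_level slow_tail_strict_decreasing by simp

lemma prob_level_sums: "(\<lambda>m. prob (level m)) sums 1"
proof -
  have "(\<lambda>m. prob (level m)) sums prob (\<Union>m. level m)"
    by (intro finite_measure_UNION) (auto simp: disjoint_family_on_def level_def)
  moreover have "(\<Union>m. level m) = space M"
    by (auto simp: level_def)
  ultimately show ?thesis
    by (simp add: prob_space)
qed

section \<open>Records in an independent sequence\<close>

abbreviation seq :: "(nat \<Rightarrow> 'a) measure" where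
  "seq \<equiv> \<Pi>\<^sub>M i\<in>UNIV. M"

sublocale seq: product_prob_space "\<lambda>_. M" "UNIV :: nat set"
  by (rule product_prob_spaceI) unfold_locales

lemma prob_seq_single:
  "A \<in> sets M \<Longrightarrow> measure seq {\<omega>\<in>space seq. \<omega> i \<in> A} = prob A"
  using seq.emeasure_PiM_Collect_single[of i A] by (simp add: measure_def)

lemma prob_seq_all:
  assumes "A \<in> sets M"
  shows "measure seq {\<omega>\<in>space seq. \<forall>i\<in>{..<n}. \<omega> i \<in> A} = prob A ^ n"
proof -
  have "emeasure seq {\<omega>\<in>space seq. \<forall>i\<in>{..<n}. \<omega> i \<in> A} = ennreal (prob A ^ n)"
    using seq.emeasure_PiM_Collect[of "{..<n}" "\<lambda>_. A"] assms
    by (simp add: emeasure_eq_measure ennreal_power)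
  then show ?thesis
    unfolding measure_def[of seq] by simp
qed

lemma prob_seq_pair:
  assumes "i \<noteq> k" "A \<in> sets M"
  shows "measure seq {\<omega>\<in>space seq. \<omega> i \<in> A \<and> \<omega> k \<in> A} = prob A * prob A"
proof -
  have "emeasure seq {\<omega>\<in>space seq. \<omega> i \<in> A \<and> \<omega> k \<in> A} = ennreal (prob A * prob A)"
    using seq.emeasure_PiM_Collect[of "{i, k}" "\<lambda>_. A"] assms
    by (simp add: emeasure_eq_measure ennreal_mult)
  then show ?thesis
    unfolding measure_def[of seq] by simp
qed

text \<open>In the sum of squared level masses over \<open>m \<ge> 2 ^ n\<close>, one factor is at
  most \<open>1 / 2 ^ n\<close> and the other sums to at most 1.\<close>

lemma prob_tie:
  assumes "i \<noteq> k"
  shows "measure seq {\<omega>\<in>space seq. J (\<omega> i) = J (\<omega> k) \<and> 2 ^ n \<le> J (\<omega> i)} \<le> 1 / 2 ^ n"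
proof -
  define T where "T m = (if 2 ^ n \<le> m then {\<omega>\<in>space seq. \<omega> i \<in> level m \<and> \<omega> k \<in> level m} else {})" for m
  have "{\<omega>\<in>space seq. J (\<omega> i) = J (\<omega> k) \<and> 2 ^ n \<le> J (\<omega> i)} = (\<Union>m. T m)"
    by (auto simp: T_def level_def space_PiM PiE_iff)
  have Tle: "measure seq (T m) \<le> 1 / 2 ^ n * prob (level m)" for m
  proof (cases "2 ^ n \<le> m")
    case True
    have "measure seq (T m) = prob (level m) * prob (level m)"
      using True prob_seq_pair[OF assms level_sets] by (simp add: T_def)
    moreover have "prob (level m) \<le> 1 / (1 + real m)"
      by (rule prob_level_le)
    moreover have "1 / (1 + real m) \<le> 1 / 2 ^ n"
    proof (intro divide_left_mono)
      have "real (2 ^ n) \<le> real m"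
        using True of_nat_le_iff by blast
      then show "2 ^ n \<le> 1 + real m"
        unfolding of_nat_power of_nat_numeral by linarith
    qed auto
    ultimately show ?thesis
      by (metis measure_nonneg mult_right_mono order_trans)
  next
    case False
    then show ?thesis
      by (simp add: T_def)
  qed
  have Tsets: "T m \<in> sets seq" for m
    unfolding T_def by (cases "2 ^ n \<le> m"; simp; measurable)
  have sm: "(\<lambda>m. 1 / 2 ^ n * prob (level m)) sums (1 / 2 ^ n * 1)"
    by (intro sums_mult prob_level_sums)
  have summ: "summable (\<lambda>m. measure seq (T m))"
    by (rule summable_comparison_test[OF _ sums_summable[OF sm]]) (use Tle in auto)
  have "measure seq (\<Union>m. T m) \<le> (\<Sum>m. measure seq (T m))"
    using Tsets summ by (intro seq.finite_measure_subadditive_countably) auto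
  also have "\<dots> \<le> (\<Sum>m. 1 / 2 ^ n * prob (level m))"
    by (intro suminf_le Tle summ sums_summable[OF sm])
  also have "\<dots> = 1 / 2 ^ n"
    using sums_unique[OF sm, symmetric] unfolding mult_1_right .
  finally show ?thesis
    unfolding \<open>_ = (\<Union>m. T m)\<close> .
qed

text \<open>The levels involved are \<open>2 ^ (i + n)\<close>, each of mass at most the reciprocal,
  so a geometric series bounds their union.\<close>

lemma prob_power_of_two:
  "prob {x\<in>space M. J x \<in> range (power 2) \<and> 2 ^ n \<le> J x} \<le> 2 / 2 ^ n"
proof -
  have "{x\<in>space M. J x \<in> range (power 2) \<and> 2 ^ n \<le> J x} \<subseteq> (\<Union>i. level (2 ^ (i + n)))"
  proof clarify
    fix x i assume "x \<in> space M" "J x = 2 ^ i" "(2 :: nat) ^ n \<le> J x"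
    moreover from this have "i - n + n = i"
      by simp
    ultimately show "x \<in> (\<Union>i. level (2 ^ (i + n)))"
      by (intro UN_I[of "i - n"]) (auto simp: level_def)
  qed
  then have "prob {x\<in>space M. J x \<in> range (power 2) \<and> 2 ^ n \<le> J x} \<le> prob (\<Union>i. level (2 ^ (i + n)))"
    by (rule finite_measure_mono) auto
  have le: "prob (level (2 ^ (i + n))) \<le> 2 / 2 ^ n * (1 / 2) ^ Suc i" for i
  proof -
    have "prob (level (2 ^ (i + n))) \<le> 1 / (1 + real (2 ^ (i + n)))"
      by (rule prob_level_le)
    also have "\<dots> \<le> 1 / 2 ^ (i + n)"
      by (intro divide_left_mono mult_pos_pos add_pos_pos) simp_all
    also have "\<dots> = 2 / 2 ^ n * (1 / 2) ^ Suc i"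
      by (simp add: power_add field_simps)
    finally show ?thesis .
  qed
  have sm: "(\<lambda>i. 2 / 2 ^ n * (1 / 2) ^ Suc i) sums (2 / 2 ^ n * (1 :: real))"
    by (intro sums_mult power_half_series)
  have summ: "summable (\<lambda>i. prob (level (2 ^ (i + n))))"
    by (rule summable_comparison_test[OF _ sums_summable[OF sm]]) (use le in auto)
  note \<open>_ \<le> prob (\<Union>i. level (2 ^ (i + n)))\<close>
  also have "prob (\<Union>i. level (2 ^ (i + n))) \<le> (\<Sum>i. prob (level (2 ^ (i + n))))"
    using summ by (intro finite_measure_subadditive_countably) auto
  also have "\<dots> \<le> (\<Sum>i. 2 / 2 ^ n * (1 / 2) ^ Suc i)"
    by (intro suminf_le le summ sums_summable[OF sm])
  also have "\<dots> = 2 / 2 ^ n"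
    using sums_unique[OF sm, symmetric] unfolding mult_1_right .
  finally show ?thesis .
qed

text \<open>By independence the exceptional event has probability
  \<open>(1 - slow_tail (2 ^ n)) ^ n\<close>, and Borel-Cantelli applies.\<close>

lemma AE_not_all_small:
  "AE \<omega> in seq. \<forall>\<^sub>F n in sequentially. \<exists>k<n. 2 ^ n \<le> J (\<omega> k)"
proof -
  define A where "A n = {\<omega>\<in>space seq. \<forall>k\<in>{..<n}. \<omega> k \<in> {x\<in>space M. \<not> 2 ^ n \<le> J x}}" for n
  have "A n \<in> sets seq" for n
    unfolding A_def by measurable
  moreover have "measure seq (A n) = (1 - slow_tail (2 ^ n)) ^ n" for n
    unfolding A_def by (subst prob_seq_all) (auto simp: prob_neg prob_J)
  ultimately have "AE \<omega> in seq. \<forall>\<^sub>F n in sequentially. \<omega> \<in> space seq - A n"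
    using summable_slow_tail_power by (intro borel_cantelli_AE1) (auto simp: seq.emeasure_eq_measure)
  then show ?thesis
    by eventually_elim (auto elim!: eventually_mono simp: A_def space_PiM)
qed

text \<open>A union bound over pairs gives at most \<open>n * n / 2 ^ n\<close>, which is
  summable.\<close>

lemma AE_no_ties:
  "AE \<omega> in seq. \<forall>\<^sub>F n in sequentially. \<forall>i<n. \<forall>k<n. i \<noteq> k \<longrightarrow> \<not> (J (\<omega> i) = J (\<omega> k) \<and> 2 ^ n \<le> J (\<omega> i))"
proof -
  define T where "T n i k = {\<omega>\<in>space seq. J (\<omega> i) = J (\<omega> k) \<and> 2 ^ n \<le> J (\<omega> i)}" for n i k
  define B where "B n = (\<Union>i\<in>{..<n}. \<Union>k\<in>{..<n} - {i}. T n i k)" for n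
  have T[measurable]: "T n i k \<in> sets seq" for n i k
    unfolding T_def by measurable
  have "B n \<in> sets seq" for n
    unfolding B_def by (intro sets.finite_UN T) auto
  moreover have Ble: "measure seq (B n) \<le> real n * (real n * (1 / 2 ^ n))" for n
  proof -
    have "measure seq (B n) \<le> (\<Sum>i<n. measure seq (\<Union>k\<in>{..<n} - {i}. T n i k))"
      unfolding B_def by (intro seq.finite_measure_subadditive_finite) (auto intro!: sets.finite_UN)
    also have "\<dots> \<le> (\<Sum>i<n. real n * (1 / 2 ^ n))"
    proof (intro sum_mono)
      fix i
      have "measure seq (\<Union>k\<in>{..<n} - {i}. T n i k) \<le> (\<Sum>k\<in>{..<n} - {i}. measure seq (T n i k))"
        by (intro seq.finite_measure_subadditive_finite) auto
      also have "\<dots> \<le> (\<Sum>k\<in>{..<n} - {i}. 1 / 2 ^ n)"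
        unfolding T_def by (intro sum_mono prob_tie) auto
      also have "\<dots> \<le> (\<Sum>k<n. 1 / 2 ^ n)"
        by (intro sum_mono2) auto
      finally show "measure seq (\<Union>k\<in>{..<n} - {i}. T n i k) \<le> real n * (1 / 2 ^ n)"
        by simp
    qed
    finally show ?thesis by simp
  qed
  moreover have "summable (\<lambda>n. measure seq (B n))"
  proof (rule summable_comparison_test_bigo)
    show "summable (\<lambda>n. norm (1 / real n ^ 2))"
      using inverse_power_summable[of 2, where 'a = real] by (simp add: field_simps)
    have "(\<lambda>n. measure seq (B n)) \<in> O(\<lambda>n. real n * (real n * (1 / 2 ^ n)))"
      using Ble by (intro bigoI[of _ 1] always_eventually allI) simp
    also have "(\<lambda>n. real n * (real n * (1 / 2 ^ n))) \<in> O(\<lambda>n. 1 / real n ^ 2)"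
      by real_asymp
    finally show "(\<lambda>n. measure seq (B n)) \<in> O(\<lambda>n. 1 / real n ^ 2)" .
  qed
  ultimately have "AE \<omega> in seq. \<forall>\<^sub>F n in sequentially. \<omega> \<in> space seq - B n"
    by (intro borel_cantelli_AE1) (auto simp: seq.emeasure_eq_measure)
  then show ?thesis
    by eventually_elim (auto elim!: eventually_mono simp: B_def T_def)
qed

lemma AE_no_large_power_of_two:
  "AE \<omega> in seq. \<forall>\<^sub>F n in sequentially. \<forall>k<n. \<not> (J (\<omega> k) \<in> range (power 2) \<and> 2 ^ n \<le> J (\<omega> k))"
proof -
  define Q where "Q n = {x\<in>space M. J x \<in> range (power 2) \<and> 2 ^ n \<le> J x}" for n
  define C where "C n = (\<Union>k\<in>{..<n}. {\<omega>\<in>space seq. \<omega> k \<in> Q n})" for n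
  have Q[measurable]: "Q n \<in> sets M" for n
    unfolding Q_def by measurable
  have meas: "{\<omega>\<in>space seq. \<omega> k \<in> Q n} \<in> sets seq" for n k
    by measurable
  have "C n \<in> sets seq" for n
    unfolding C_def by (intro sets.finite_UN meas) auto
  moreover have Cle: "measure seq (C n) \<le> real n * (2 / 2 ^ n)" for n
  proof -
    have "measure seq (C n) \<le> (\<Sum>k<n. measure seq {\<omega>\<in>space seq. \<omega> k \<in> Q n})"
      unfolding C_def using meas by (intro seq.finite_measure_subadditive_finite) auto
    also have "\<dots> \<le> (\<Sum>k<n. 2 / 2 ^ n)"
      unfolding prob_seq_single[OF Q] using prob_power_of_two[of n] by (intro sum_mono) (simp add: Q_def)
    finally show ?thesis by simp
  qed
  moreover have "summable (\<lambda>n. measure seq (C n))"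
  proof (rule summable_comparison_test_bigo)
    show "summable (\<lambda>n. norm (1 / real n ^ 2))"
      using inverse_power_summable[of 2, where 'a = real] by (simp add: field_simps)
    have "(\<lambda>n. measure seq (C n)) \<in> O(\<lambda>n. real n * (2 / 2 ^ n))"
      using Cle by (intro bigoI[of _ 1] always_eventually allI) simp
    also have "(\<lambda>n. real n * (2 / 2 ^ n)) \<in> O(\<lambda>n. 1 / real n ^ 2)"
      by real_asymp
    finally show "(\<lambda>n. measure seq (C n)) \<in> O(\<lambda>n. 1 / real n ^ 2)" .
  qed
  ultimately have "AE \<omega> in seq. \<forall>\<^sub>F n in sequentially. \<omega> \<in> space seq - C n"
    by (intro borel_cantelli_AE1) (auto simp: seq.emeasure_eq_measure)
  then show ?thesis
    by eventually_elim (auto elim!: eventually_mono simp: C_def Q_def space_PiM)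
qed

text \<open>The maximum is at least \<open>2 ^ n\<close>, and from that height on ties and powers of
  two are excluded. Only the weaker bound \<open>n\<close> is kept for the geometric part.\<close>

lemma AE_unique_record:
  "AE \<omega> in seq. \<forall>\<^sub>F n in sequentially. \<exists>k<n. n \<le> J (\<omega> k) \<and> J (\<omega> k) \<notin> range (power 2) \<and>
     (\<forall>i<n. i \<noteq> k \<longrightarrow> J (\<omega> i) < J (\<omega> k))"
  using AE_not_all_small AE_no_ties AE_no_large_power_of_two
proof eventually_elim
  case (elim \<omega>)
  then show ?case
  proof eventually_elim
    case (elim n)
    then obtain k0 where k0: "k0 < n" "2 ^ n \<le> J (\<omega> k0)"
      by blast
    define m where "m = Max ((\<lambda>k. J (\<omega> k)) ` {..<n})"
    have "m \<in> (\<lambda>k. J (\<omega> k)) ` {..<n}"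
      unfolding m_def using k0 by (intro Max_in) auto
    then obtain k where k: "k < n" "J (\<omega> k) = m"
      by auto
    have le: "J (\<omega> i) \<le> m" if "i < n" for i
      unfolding m_def using that by (intro Max_ge) auto
    then have "2 ^ n \<le> m"
      using k0 order_trans by blast
    then have "n \<le> m"
      using less_exp[of n] by linarith
    moreover have "J (\<omega> i) < m" if "i < n" "i \<noteq> k" for i
    proof -
      have "J (\<omega> i) \<noteq> m"
        using elim(2) that k \<open>2 ^ n \<le> m\<close> by auto
      then show ?thesis
        using le[OF that(1)] by simp
    qed
    moreover have "m \<notin> range (power 2)"
      using elim(3) k \<open>2 ^ n \<le> m\<close> by auto
    ultimately show ?case
      using k by (intro exI[of _ k]) auto
  qed
qed

end

section \<open>Realising the tail by a uniform variable\<close>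

definition uniform_01 :: "real measure" where
  "uniform_01 = restrict_space lborel {0<..1}"

lemma space_uniform_01 [simp]: "space uniform_01 = {0<..1}"
  by (simp add: uniform_01_def space_restrict_space)

lemma emeasure_uniform_01:
  "A \<in> sets borel \<Longrightarrow> A \<subseteq> {0<..1} \<Longrightarrow> emeasure uniform_01 A = emeasure lborel A"
  unfolding uniform_01_def by (intro emeasure_restrict_space) auto

lemma prob_space_uniform_01: "prob_space uniform_01"
  by (rule prob_spaceI) (simp add: emeasure_uniform_01)

lemma measurable_uniform_01: "f \<in> borel_measurable borel \<Longrightarrow> f \<in> borel_measurable uniform_01"
  unfolding uniform_01_def by (intro measurable_restrict_space1) simp

text \<open>The equation \<open>u = slow_tail m\<close> solved for real \<open>m\<close> and rounded
  down, so that a uniform \<open>u\<close> produces a level with exactly this tail. The interval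
  excludes 0 because of the division by \<open>u\<close>.\<close>

definition level_of :: "real \<Rightarrow> nat" where
  "level_of u = nat \<lfloor>exp (exp (1 / u - 1) - 1) - 1\<rfloor>"

lemma ln_le_iff_le_exp: "0 < x \<Longrightarrow> ln x \<le> z \<longleftrightarrow> x \<le> exp (z :: real)"
  by (metis exp_le_cancel_iff exp_ln)

lemma le_level_of_iff:
  assumes "0 < u" "u \<le> 1"
  shows "m \<le> level_of u \<longleftrightarrow> u \<le> slow_tail m"
proof -
  let ?L = "ln (1 + ln (1 + real m))"
  have L0: "0 \<le> ln (1 + real m)" "0 \<le> ?L"
    by (simp_all add: ln_ge_zero)
  \<comment> \<open>The value before rounding is nonnegative, so \<open>nat\<close> does not distort
    it.\<close>
  have "1 \<le> exp (1 / u - 1)" "1 \<le> exp (exp (1 / u - 1) - 1)"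
    using assms by (simp_all add: field_simps)
  then have "m \<le> level_of u \<longleftrightarrow> 1 + real m \<le> exp (exp (1 / u - 1) - 1)"
    unfolding level_of_def by linarith
  also have "\<dots> \<longleftrightarrow> ln (1 + real m) \<le> exp (1 / u - 1) - 1"
    by (subst ln_le_iff_le_exp) simp_all
  also have "\<dots> \<longleftrightarrow> 1 + ln (1 + real m) \<le> exp (1 / u - 1)"
    by linarith
  also have "\<dots> \<longleftrightarrow> ?L \<le> 1 / u - 1"
    using L0 by (subst ln_le_iff_le_exp) linarith+
  also have "\<dots> \<longleftrightarrow> u \<le> slow_tail m"
  proof -
    have "0 < 1 + ?L"
      using L0(2) by linarith
    then have "u \<le> slow_tail m \<longleftrightarrow> (1 + ?L) * u \<le> 1"
      unfolding slow_tail_def by (simp only: pos_le_divide_eq mult.commute)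
    then show ?thesis
      using assms(1) by (simp add: field_simps)
  qed
  finally show ?thesis .
qed

lemma measurable_level_of [measurable]: "level_of \<in> measurable uniform_01 (count_space UNIV)"
proof -
  have "(\<lambda>u :: real. exp (exp (1 / u - 1) - 1) - 1) \<in> borel_measurable uniform_01"
    by (rule measurable_uniform_01) measurable
  then have "(\<lambda>u. \<lfloor>exp (exp (1 / u - 1) - 1) - 1\<rfloor>) \<in> measurable uniform_01 (count_space UNIV)"
    by (rule measurable_compose[OF _ measurable_real_floor])
  from measurable_compose[OF this measurable_count_space, of nat] show ?thesis
    unfolding level_of_def[abs_def] by simp
qed

lemma slow_level_uniform: "slow_level uniform_01 level_of"
proof -
  have "emeasure uniform_01 {x\<in>space uniform_01. m \<le> level_of x} = ennreal (slow_tail m)" for m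
  proof -
    have "{x\<in>space uniform_01. m \<le> level_of x} = {0<..slow_tail m}"
    proof (intro Set.set_eqI iffI)
      fix x assume "x \<in> {x\<in>space uniform_01. m \<le> level_of x}"
      then have "0 < x" "x \<le> 1" "m \<le> level_of x"
        by simp_all
      then show "x \<in> {0<..slow_tail m}"
        using le_level_of_iff[of x m] by simp
    next
      fix x assume "x \<in> {0<..slow_tail m}"
      then have x: "0 < x" "x \<le> slow_tail m"
        by simp_all
      then have "x \<le> 1"
        using slow_tail_le_1[of m] by linarith
      then show "x \<in> {x\<in>space uniform_01. m \<le> level_of x}"
        using le_level_of_iff[of x m] x by simp
    qed
    moreover have "emeasure uniform_01 {0<..slow_tail m} = emeasure lborel {0<..slow_tail m}"
    proof (rule emeasure_uniform_01)
      have "x \<in> {0<..1}" if "x \<in> {0<..slow_tail m}" for x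
        using that slow_tail_le_1[of m] unfolding greaterThanAtMost_iff by linarith
      then show "{0<..slow_tail m} \<subseteq> {0<..1}"
        by blast
    qed simp
    moreover have "emeasure lborel {0<..slow_tail m} = ennreal (slow_tail m)"
      using slow_tail_pos[of m] by simp
    ultimately show ?thesis
      by simp
  qed
  then have "measure uniform_01 {x\<in>space uniform_01. m \<le> level_of x} = slow_tail m" for m
    unfolding measure_def using slow_tail_pos[of m] by simp
  then show ?thesis
    using prob_space_uniform_01 measurable_level_of
    by (intro slow_level.intro slow_level_axioms.intro)
qed

section \<open>The random walk\<close>

text \<open>Strict inequalities and continuity of inversion make this a union of relatively open
  sets, one for each pair \<open>h\<close>, \<open>h'\<close>.\<close>

lemma openin_near_rational: "\<exists>V. open V \<and> near_rational m d = {g :: real^'n^'n. det g = 1} \<inter> V"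
proof -
  have "openin (top_of_set {g :: real^'n^'n. det g = 1}) ({g. det g = 1} \<inter> matrix_inv -` ball h' d)" for h' :: "real^'n^'n"
    by (intro continuous_openin_preimage_gen continuous_on_matrix_inv open_ball)
  moreover have "openin (top_of_set {g :: real^'n^'n. det g = 1}) ({g. det g = 1} \<inter> ball h d)" for h :: "real^'n^'n"
    by (intro openin_open_Int open_ball)
  ultimately have "openin (top_of_set {g :: real^'n^'n. det g = 1})
      (({g. det g = 1} \<inter> ball h d) \<inter> ({g. det g = 1} \<inter> matrix_inv -` ball h' d))" for h h' :: "real^'n^'n"
    by (rule openin_Int[rotated])
  then have "openin (top_of_set {g :: real^'n^'n. det g = 1})
      (\<Union>x\<in>{x. int_height m (fst x) (snd x)}.
        ({g. det g = 1} \<inter> ball (fst x) d) \<inter> ({g. det g = 1} \<inter> matrix_inv -` ball (snd x) d))"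
    by (intro openin_Union) blast
  also have "(\<Union>x\<in>{x. int_height m (fst x) (snd x)}.
      ({g :: real^'n^'n. det g = 1} \<inter> ball (fst x) d) \<inter> ({g. det g = 1} \<inter> matrix_inv -` ball (snd x) d)) =
      near_rational m d"
    by (auto simp: near_rational_def dist_norm norm_minus_commute) blast+
  finally show ?thesis
    by (auto simp: openin_open)
qed

lemma space_SL_borel: "space SL_borel = {g :: real^'n^'n. det g = 1}"
  by (auto simp: SL_borel_def space_restrict_space)

lemma open_Int_SL_sets: "open V \<Longrightarrow> {g :: real^'n^'n. det g = 1} \<inter> V \<in> sets SL_borel"
  by (auto simp: SL_borel_def sets_restrict_space SL_def)

lemma near_rational_sets: "(near_rational m d :: (real^'n^'n) set) \<in> sets SL_borel"
proof -
  obtain V where "open V" "near_rational m d = {g :: real^'n^'n. det g = 1} \<inter> V"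
    using openin_near_rational by blast
  then show ?thesis
    using open_Int_SL_sets by simp
qed

lemma measurable_SL_borelI:
  assumes "f \<in> borel_measurable M" "\<And>x. x \<in> space M \<Longrightarrow> det (f x) = 1"
  shows "f \<in> measurable M (SL_borel :: (real^'n^'n) measure)"
  unfolding SL_borel_def using assms by (intro measurable_restrict_space2) auto

lemma continuous_measurable_SL:
  fixes f :: "real^'n^'n \<Rightarrow> real^'n^'n"
  assumes "continuous_on {g. det g = 1} f" "\<And>g. det g = 1 \<Longrightarrow> det (f g) = 1"
  shows "f \<in> measurable SL_borel SL_borel"
proof (rule measurable_SL_borelI)
  show "f \<in> borel_measurable SL_borel"
    using borel_measurable_continuous_on_restrict[OF assms(1)] by (simp add: SL_borel_def SL_def)
qed (use assms in \<open>simp add: space_SL_borel\<close>)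

lemma continuous_on_shear [continuous_intros]:
  "continuous_on S f \<Longrightarrow> continuous_on S (\<lambda>x. shear p q (f x))"
  unfolding shear_def by (intro continuous_intros)

lemma liouville_measurable: "liouville c \<in> borel_measurable uniform_01"
proof -
  have "(\<lambda>x::real. real_of_int \<lfloor>real l * x\<rfloor>) \<in> borel_measurable borel" for l
    by (rule measurable_compose[OF _ borel_measurable_real_floor]) simp
  then have "(\<lambda>x::real. liouville_term c x l) \<in> borel_measurable borel" for l
    unfolding liouville_term_def by (intro borel_measurable_divide) simp_all
  then have "(\<lambda>x. \<Sum>l. liouville_term c x l) \<in> borel_measurable borel"
    by (rule borel_measurable_suminf)
  then show ?thesis
    using measurable_uniform_01 unfolding liouville_def[abs_def] by blast
qed

section \<open>The random parameters of one step\<close>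

definition fair_coin :: "bool measure" where
  "fair_coin = measure_pmf (pmf_of_set UNIV)"

lemma space_fair_coin [simp]: "space fair_coin = UNIV"
  by (simp add: fair_coin_def)

lemma sets_fair_coin [simp]: "sets fair_coin = UNIV"
  by (simp add: fair_coin_def)

lemma prob_space_fair_coin: "prob_space fair_coin"
  unfolding fair_coin_def by (rule prob_space_measure_pmf)

lemma distr_fair_coin_Not: "distr fair_coin fair_coin Not = fair_coin"
proof -
  have "map_pmf Not (pmf_of_set UNIV) = pmf_of_set (UNIV :: bool set)"
    by (rule map_pmf_of_set_bij_betw) (auto simp: bij_betw_def inj_on_def)
  then have "distr (measure_pmf (pmf_of_set UNIV)) (count_space UNIV) Not = measure_pmf (pmf_of_set (UNIV :: bool set))"
    by (metis map_pmf_rep_eq)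
  moreover have "distr fair_coin fair_coin Not = distr fair_coin (count_space UNIV) Not"
    by (rule distr_cong) simp_all
  ultimately show ?thesis
    by (simp add: fair_coin_def)
qed

text \<open>The coin chooses between a matrix and its inverse, the first uniform variable determines
  the level, the second is the argument of the Liouville series.\<close>

definition step_params :: "((bool \<times> real) \<times> real) measure" where
  "step_params = (fair_coin \<Otimes>\<^sub>M uniform_01) \<Otimes>\<^sub>M uniform_01"

lemma space_step_params: "space step_params = (UNIV \<times> {0<..1}) \<times> {0<..1}"
  by (simp add: step_params_def space_pair_measure)

lemma prob_space_step_params: "prob_space step_params"
proof -
  interpret C: prob_space fair_coin by (rule prob_space_fair_coin)
  interpret U: prob_space uniform_01 by (rule prob_space_uniform_01)
  interpret CU: pair_prob_space fair_coin uniform_01 by unfold_locales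
  interpret CUU: pair_prob_space "fair_coin \<Otimes>\<^sub>M uniform_01" uniform_01 by unfold_locales
  show ?thesis
    unfolding step_params_def by unfold_locales
qed

lemma emeasure_step_params_Times:
  assumes "B \<in> sets uniform_01" "D \<in> sets uniform_01"
  shows "emeasure step_params ((A \<times> B) \<times> D) = emeasure fair_coin A * emeasure uniform_01 B * emeasure uniform_01 D"
proof -
  interpret U: prob_space uniform_01 by (rule prob_space_uniform_01)
  show ?thesis
    unfolding step_params_def using assms by (simp add: U.emeasure_pair_measure_Times)
qed

lemma distr_step_params_flip:
  "distr step_params step_params (\<lambda>((s, u), x). ((\<not> s, u), x)) = step_params"
proof -
  interpret C: prob_space fair_coin by (rule prob_space_fair_coin)
  interpret U: prob_space uniform_01 by (rule prob_space_uniform_01)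
  have U: "distr uniform_01 uniform_01 (\<lambda>x. x) = uniform_01"
    by (rule distr_id2) simp
  have Not: "Not \<in> measurable fair_coin fair_coin"
    by (simp add: measurable_def)
  have 1: "distr (fair_coin \<Otimes>\<^sub>M uniform_01) (fair_coin \<Otimes>\<^sub>M uniform_01) (\<lambda>(s, u). (\<not> s, u)) = fair_coin \<Otimes>\<^sub>M uniform_01"
    using pair_measure_distr[OF Not, of "\<lambda>x. x" uniform_01 uniform_01] U.sigma_finite_measure_axioms
    by (simp add: U distr_fair_coin_Not)
  have "(\<lambda>(s, u). (\<not> s, u)) \<in> measurable (fair_coin \<Otimes>\<^sub>M uniform_01) (fair_coin \<Otimes>\<^sub>M uniform_01)"
    using Not unfolding split_beta' by (intro measurable_Pair measurable_snd) (auto intro: measurable_compose[OF measurable_fst])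
  from pair_measure_distr[OF this, of "\<lambda>x. x" uniform_01 uniform_01] show ?thesis
    using U.sigma_finite_measure_axioms
    by (simp add: U 1[unfolded split_beta'] step_params_def split_beta')
qed

text \<open>By Fubini it suffices that each slice in the last coordinate is Lebesgue null, and a
  slice has at most one point.\<close>

lemma step_params_slice_null:
  assumes "X \<in> sets step_params" "\<And>a. \<exists>x0. Pair a -` X \<subseteq> {x0}"
  shows "emeasure step_params X = 0"
proof -
  interpret U: prob_space uniform_01 by (rule prob_space_uniform_01)
  have "emeasure step_params X = (\<integral>\<^sup>+a. emeasure uniform_01 (Pair a -` X) \<partial>(fair_coin \<Otimes>\<^sub>M uniform_01))"
    using assms(1) unfolding step_params_def by (rule U.emeasure_pair_measure_alt)
  also have "\<dots> = (\<integral>\<^sup>+a. 0 \<partial>(fair_coin \<Otimes>\<^sub>M uniform_01))"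
  proof (rule nn_integral_cong)
    fix a assume "a \<in> space (fair_coin \<Otimes>\<^sub>M uniform_01)"
    obtain x0 where x0: "Pair a -` X \<subseteq> {x0}"
      using assms(2) by blast
    have fin: "finite (Pair a -` X)"
      using x0 finite_subset by blast
    have "Pair a -` X \<in> sets uniform_01"
      using assms(1) unfolding step_params_def by (rule sets_Pair1)
    then have "Pair a -` X \<subseteq> {0<..1}"
      using sets.sets_into_space by fastforce
    then have "emeasure uniform_01 (Pair a -` X) = emeasure lborel (Pair a -` X)"
      using fin by (intro emeasure_uniform_01 borel_closed finite_imp_closed)
    also have "\<dots> = 0"
      using fin by (intro emeasure_lborel_countable countable_finite)
    finally show "emeasure uniform_01 (Pair a -` X) = 0" .
  qed
  finally show ?thesis by simp
qed

definition param_level :: "(bool \<times> real) \<times> real \<Rightarrow> nat" where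
  "param_level w = level_of (snd (fst w))"

lemma measurable_param_level: "param_level \<in> measurable step_params (count_space UNIV)"
proof -
  have "(\<lambda>w. snd (fst w)) \<in> measurable step_params uniform_01"
    unfolding step_params_def by (rule measurable_compose[OF measurable_fst measurable_snd])
  from measurable_compose[OF this measurable_level_of] show ?thesis
    unfolding param_level_def[abs_def] .
qed

lemma slow_level_step_params: "slow_level step_params param_level"
proof -
  interpret C: prob_space fair_coin by (rule prob_space_fair_coin)
  interpret U: slow_level uniform_01 level_of by (rule slow_level_uniform)
  have "measure step_params {w\<in>space step_params. m \<le> param_level w} = slow_tail m" for m
  proof -
    have *: "{u\<in>space uniform_01. m \<le> level_of u} \<in> sets uniform_01"
      by measurable
    have "{w\<in>space step_params. m \<le> param_level w} = (UNIV \<times> {u\<in>space uniform_01. m \<le> level_of u}) \<times> space uniform_01"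
      by (auto simp: space_step_params param_level_def)
    then have "emeasure step_params {w\<in>space step_params. m \<le> param_level w} =
        emeasure fair_coin UNIV * emeasure uniform_01 {u\<in>space uniform_01. m \<le> level_of u} * emeasure uniform_01 (space uniform_01)"
      using emeasure_step_params_Times[OF * sets.top] by simp
    also have "\<dots> = ennreal (slow_tail m)"
      using C.emeasure_space_1 U.emeasure_space_1 U.prob_J[of m] U.emeasure_eq_measure by simp
    finally show ?thesis
      unfolding measure_def using slow_tail_pos[of m] by simp
  qed
  then show ?thesis
    using prob_space_step_params measurable_param_level by (intro slow_level.intro slow_level_axioms.intro)
qed

text \<open>The exponents 3 and 7 balance the two terms of the second factor: \<open>M / b\<close>
  and \<open>b * M ^ 2 * d\<close> both equal \<open>1 / M ^ 2\<close>. The first factor is at most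
  \<open>2 * M\<close>.\<close>

lemma record_bound:
  fixes M b d C :: real
  assumes "M \<ge> 1" "b = M ^ 3" "d = 1 / M ^ 7" "C \<ge> 0"
  shows "(M + d) * (M / b + C * b * M\<^sup>2 * d) \<le> 2 * (1 + C) / M"
proof -
  have "M / b = 1 / M\<^sup>2" "b * M\<^sup>2 * d = 1 / M\<^sup>2"
    using assms by (simp_all add: field_simps power_add[symmetric] eval_nat_numeral)
  then have eq: "M / b + C * b * M\<^sup>2 * d = (1 + C) / M\<^sup>2"
    by (simp add: add_divide_distrib mult.assoc)
  have "d \<le> 1"
    using assms by simp
  then have "(M + d) * ((1 + C) / M\<^sup>2) \<le> (2 * M) * ((1 + C) / M\<^sup>2)"
    using assms(1,4) by (intro mult_right_mono) auto
  also have "\<dots> = 2 * (1 + C) / M"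
    using assms by (simp add: field_simps power2_eq_square)
  finally show ?thesis
    by (simp add: eq)
qed

locale heavy_walk =
  fixes p q :: "'n::finite" and c :: nat and e :: "nat \<Rightarrow> real^'n^'n"
  assumes pq: "p \<noteq> q" and c: "CARD('n) < c"
    and e_det: "\<And>j. det (e j) = 1"
    and e_height: "\<And>j. \<exists>h'. int_height (real (denom c (Suc j))) (e j) h'"
    and e_big: "\<And>j. j \<notin> range (power 2) \<Longrightarrow> e j = two_diag p q (big_factor c j)"
    and e_dense: "\<And>U. open U \<Longrightarrow> U \<inter> {g. det g = 1} \<noteq> {} \<Longrightarrow> \<exists>j. e j \<in> U"
begin

lemma c_gt_1: "c > 1"
  using c zero_less_card_finite[where 'a = 'n] by linarith

section \<open>The exceptional set of lattices\<close>

definition near :: "nat \<Rightarrow> (real^'n^'n) set" where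
  "near j = near_rational (real (denom c j) ^ 2) (denom_tol c j)"

text \<open>This is the set \<open>S\<close>. The representative in \<open>near j\<close> may depend
  on \<open>j\<close>, and the shape, a countable union of countable intersections of open sets,
  gives measurability directly.\<close>

definition limit_points :: "(real^'n^'n) set set" where
  "limit_points = (\<Union>j0. \<Inter>j\<in>{j0<..}. (\<lambda>g. g <#\<^bsub>SL\<^esub> SLZ) ` near j)"

lemma openin_near_image: "openin X_top ((\<lambda>g. g <#\<^bsub>SL\<^esub> SLZ) ` near j)"
  unfolding near_def using openin_near_rational openin_X_top_image by metis

lemma limit_points_subset: "limit_points \<subseteq> topspace X_top"
proof
  fix x assume "x \<in> limit_points"
  then obtain j0 where "\<And>j. j > j0 \<Longrightarrow> x \<in> (\<lambda>g. g <#\<^bsub>SL\<^esub> SLZ) ` near j"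
    by (auto simp: limit_points_def)
  from this[of "Suc j0"] show "x \<in> topspace X_top"
    using openin_near_image openin_subset by blast
qed

lemma limit_points_measurable: "limit_points \<in> sets (borel_of_topology X_top)"
proof -
  have "{U :: (real^'n^'n) set set. openin X_top U} \<subseteq> Pow (topspace X_top)"
    using openin_subset by blast
  then have "(\<lambda>g. g <#\<^bsub>SL\<^esub> SLZ) ` near j \<in> sets (borel_of_topology X_top)" for j
    unfolding borel_of_topology_def using openin_near_image by (simp add: sigma_sets.Basic)
  then show ?thesis
    unfolding limit_points_def
    by (intro sets.countable_UN sets.countable_INT' image_subsetI) auto
qed

text \<open>The matrix of level \<open>l\<close> has its height bounded only by
  \<open>denom c (Suc l)\<close>, hence the strict inequality.\<close>

lemma level_matrix_near:
  assumes "l < j" "0 < x" "x \<le> 1"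
  shows "e l ** shear p q (liouville c x) \<in> near j"
proof -
  obtain h' where h': "int_height (real (denom c (Suc l))) (e l) h'"
    using e_height by blast
  have "int_height (real (denom c j)) (e l) h'"
    using int_height_denom_mono[OF h'] assms(1) c_gt_1 by simp
  then show ?thesis
    unfolding near_def using near_rational_liouville[OF pq c assms(2,3) _ e_det] by blast
qed

lemma int_height_one: "int_height (real (denom c j)) (mat 1 :: real^'n^'n) (mat 1)"
proof -
  have "c \<le> denom c j"
    using denom_ge c_gt_1 by simp
  then show ?thesis
    using int_height_shear[OF pq, of "real (denom c j)" 0] c by (simp add: shear_0)
qed

lemma shear_near:
  assumes "0 < x" "x \<le> 1"
  shows "shear p q (liouville c x) \<in> near j"
  unfolding near_def using near_rational_liouville[OF pq c assms int_height_one] by simp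

text \<open>Shears by Liouville numbers give pairwise distinct lattices: equality of two would make
  the difference of two numbers in [0, 1) an integer.\<close>

lemma uncountable_limit_points: "uncountable limit_points"
proof -
  define f :: "real \<Rightarrow> (real^'n^'n) set" where "f x = shear p q (liouville c x) <#\<^bsub>SL\<^esub> SLZ" for x
  have "f x \<in> limit_points" if "x \<in> {0<..1}" for x
    using shear_near[of x] that by (auto simp: limit_points_def f_def)
  then have sub: "f ` {0<..1} \<subseteq> limit_points"
    by blast
  have "inj_on f {0<..1}"
  proof (rule inj_onI)
    fix x y assume xy: "x \<in> {0<..1}" "y \<in> {0<..1}" "f x = f y"
    then obtain s where s: "s \<in> SLZ" "shear p q (liouville c y) = shear p q (liouville c x) ** s"
      unfolding f_def lcoset_SLZ_eq_iff by blast
    have "shear p q (liouville c y - liouville c x) = shear p q (- liouville c x) ** shear p q (liouville c y)"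
      by (simp add: shear_mult[OF pq])
    also have "\<dots> = s"
      unfolding s(2) by (simp add: matrix_mul_assoc shear_mult[OF pq] shear_0)
    finally have "shear p q (liouville c y - liouville c x) $ p $ q \<in> \<int>"
      using s(1) by (simp add: SLZ_def)
    then have "liouville c y - liouville c x \<in> \<int>"
      using pq by (simp add: shear_nth)
    moreover have "0 \<le> liouville c x" "liouville c x < 1" "0 \<le> liouville c y" "liouville c y < 1"
      using xy liouville_nonneg[of c] liouville_less_1[of c] c_gt_1 by auto
    ultimately have "liouville c x = liouville c y"
      using Ints_eq_abs_less1[of "liouville c y - liouville c x" 0] by auto
    then show "x = y"
      using liouville_strict_mono[of c x y] liouville_strict_mono[of c y x] xy c_gt_1
      by (cases x y rule: linorder_cases) auto
  qed
  moreover have "uncountable {0<..1::real}"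
    by (rule uncountable_half_open_interval_2[of 0 1, THEN iffD2]) simp
  ultimately have "uncountable (f ` {0<..1})"
    by (metis countable_image_inj_on)
  then show ?thesis
    using sub countable_subset by blast
qed

lemma rational_near:
  fixes r :: "real^'n^'n"
  assumes "det r = 1" "\<forall>i j. r $ i $ j \<in> \<rat>"
  shows "\<exists>j0. \<forall>j>j0. r \<in> near j"
proof -
  obtain j0 where j0: "\<And>j. j \<ge> j0 \<Longrightarrow> int_height (real (denom c j)) r (matrix_inv r)"
    using rational_int_height[OF assms, of c] c_gt_1 by (auto simp: eventually_sequentially)
  have "r \<in> near j" if "j > j0" for j
  proof -
    have "denom c j > 0"
      using denom_pos c_gt_1 by simp
    then have "int_height (real (denom c j) * real (denom c j)) r (matrix_inv r)" "0 < denom_tol c j"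
      using j0[of j] that by (auto intro!: int_height_scale simp: denom_tol_def)
    then have "int_height (real (denom c j) ^ 2) r (matrix_inv r) \<and> norm (r - r) < denom_tol c j \<and>
        norm (matrix_inv r - matrix_inv r) < denom_tol c j"
      by (simp add: power2_eq_square)
    then show ?thesis
      using assms(1) unfolding near_def near_rational_def by blast
  qed
  then show ?thesis
    by blast
qed

text \<open>Lattices of rational matrices belong to the set, and such matrices are dense in the
  group.\<close>

lemma dense_limit_points: "X_top closure_of limit_points = topspace X_top"
proof -
  have "\<exists>y\<in>limit_points. y \<in> T" if T: "openin X_top T" "x \<in> T" for x T
  proof -
    obtain V where V: "open V" "{g \<in> carrier SL. g <#\<^bsub>SL\<^esub> SLZ \<in> T} = carrier SL \<inter> V"
      using T(1) unfolding X_top_def openin_quotient_topology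
      by (auto simp: SL_top_def openin_open)
    have "x \<in> topspace X_top"
      using T openin_subset by blast
    then obtain g :: "real^'n^'n" where g: "det g = 1" "x = g <#\<^bsub>SL\<^esub> SLZ"
      by (auto simp: topspace_X_top_eq)
    have "g \<in> V"
      using V(2) g T(2) by auto
    obtain r where r: "r \<in> V" "det r = 1" "\<forall>i j. r $ i $ j \<in> \<rat>"
      using rational_SL_dense[OF g(1) V(1) \<open>g \<in> V\<close>] by blast
    have "r <#\<^bsub>SL\<^esub> SLZ \<in> T"
      using V(2) r by auto
    moreover have "r <#\<^bsub>SL\<^esub> SLZ \<in> limit_points"
      using rational_near[OF r(2,3)] unfolding limit_points_def by blast
    ultimately show ?thesis
      by blast
  qed
  then show ?thesis
    unfolding closure_of_def by (intro Set.equalityI subsetI) auto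
qed

section \<open>The law of a step: symmetry, no atoms, full support\<close>

definition step :: "(bool \<times> real) \<times> real \<Rightarrow> real^'n^'n" where
  "step w = (let g = e (param_level w) ** shear p q (liouville c (snd w))
             in if fst (fst w) then g else matrix_inv g)"

lemma det_level_matrix: "det (e j ** shear p q t) = 1"
  by (simp add: det_mul e_det det_shear[OF pq])

lemma det_step: "det (step w) = 1"
  by (simp add: step_def Let_def det_level_matrix matrix_inv_SL)

lemma inv_level_matrix: "matrix_inv (e j ** shear p q t) = shear p q (- t) ** matrix_inv (e j)"
  using matrix_inv_eqI[OF shear_mult_minus[OF pq, of t]]
  by (simp add: matrix_inv_mult e_det det_shear[OF pq])

lemma step_measurable: "step \<in> measurable step_params SL_borel"
proof (rule measurable_SL_borelI)
  \<comment> \<open>For each of the countably many values of coin and level, the step is a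
    continuous function of the Liouville number; measurability follows by countable gluing.\<close>
  define F where "F i t = (if fst i then e (snd i) ** shear p q t else shear p q (- t) ** matrix_inv (e (snd i)))"
    for i :: "bool \<times> nat" and t
  have "continuous_on UNIV (F i)" for i
    by (cases "fst i") (simp_all add: F_def[abs_def] continuous_intros)
  then have "F i \<in> borel_measurable borel" for i
    by (rule borel_measurable_continuous_onI)
  moreover have "(\<lambda>w. liouville c (snd w)) \<in> borel_measurable step_params"
    unfolding step_params_def by (rule measurable_compose[OF measurable_snd liouville_measurable])
  ultimately have F: "(\<lambda>w. F i (liouville c (snd w))) \<in> borel_measurable step_params" for i
    using measurable_compose by blast
  have "(\<lambda>w. fst (fst w)) \<in> measurable step_params fair_coin"
    unfolding step_params_def by (rule measurable_compose[OF measurable_fst measurable_fst])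
  then have "(\<lambda>w. fst (fst w)) \<in> measurable step_params (count_space UNIV)"
    by (simp add: measurable_def fair_coin_def)
  then have "(\<lambda>w. (fst (fst w), param_level w)) \<in> measurable step_params (count_space UNIV \<Otimes>\<^sub>M count_space UNIV)"
    using measurable_param_level by (rule measurable_Pair)
  then have "(\<lambda>w. (fst (fst w), param_level w)) \<in> measurable step_params (count_space UNIV)"
    by (simp add: pair_measure_countable)
  from measurable_compose_countable[where f = "\<lambda>i w. F i (liouville c (snd w))", OF F this] show "step \<in> borel_measurable step_params"
    by (simp add: F_def step_def[abs_def] Let_def inv_level_matrix cong: if_cong)
qed (rule det_step)

definition \<mu> :: "(real^'n^'n) measure" where
  "\<mu> = distr step_params SL_borel step"

lemma sets_\<mu>: "sets \<mu> = sets SL_borel" and space_\<mu>: "space \<mu> = {g. det g = 1}"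
  by (simp_all add: \<mu>_def space_SL_borel)

lemma SL_prob_\<mu>: "SL_prob \<mu>"
  using prob_space.prob_space_distr[OF prob_space_step_params step_measurable]
  by (auto simp: SL_prob_def \<mu>_def space_SL_borel SL_def)

lemma matrix_inv_measurable: "matrix_inv \<in> measurable SL_borel (SL_borel :: (real^'n^'n) measure)"
  by (intro continuous_measurable_SL continuous_on_matrix_inv matrix_inv_SL)

lemma symmetric_\<mu>: "symmetric_measure \<mu>"
proof -
  define flip :: "(bool \<times> real) \<times> real \<Rightarrow> (bool \<times> real) \<times> real" where "flip = (\<lambda>((s, u), x). ((\<not> s, u), x))"
  have flip_distr: "distr step_params step_params flip = step_params"
    unfolding flip_def by (rule distr_step_params_flip)
  have flip_inv: "step (flip w) = matrix_inv (step w)" for w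
    by (auto simp: step_def flip_def param_level_def Let_def split_beta' matrix_inv_matrix_inv det_level_matrix)
  have flip_meas: "flip \<in> measurable step_params step_params"
  proof -
    have "Not \<in> measurable fair_coin fair_coin"
      by (simp add: measurable_def)
    then have "(\<lambda>w. \<not> fst (fst w)) \<in> measurable step_params fair_coin"
      unfolding step_params_def
      by (rule measurable_compose[rotated]) (rule measurable_compose[OF measurable_fst measurable_fst])
    then show ?thesis
      unfolding flip_def step_params_def split_beta'
      by (intro measurable_Pair measurable_snd measurable_compose[OF measurable_fst measurable_snd])
  qed
  have "distr \<mu> \<mu> (\<lambda>g. inv\<^bsub>SL\<^esub> g) = distr \<mu> SL_borel matrix_inv"
    by (rule distr_cong) (auto simp: sets_\<mu> space_\<mu> m_inv_SL)
  also have "\<dots> = distr step_params SL_borel (matrix_inv \<circ> step)"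
    unfolding \<mu>_def by (rule distr_distr[OF matrix_inv_measurable step_measurable])
  also have "\<dots> = distr step_params SL_borel (step \<circ> flip)"
    by (rule distr_cong) (auto simp: flip_inv)
  also have "\<dots> = distr (distr step_params step_params flip) SL_borel step"
    by (rule distr_distr[symmetric, OF step_measurable flip_meas])
  also have "\<dots> = \<mu>"
    by (simp add: flip_distr \<mu>_def)
  finally show ?thesis
    by (simp add: symmetric_measure_def)
qed

text \<open>With coin and level fixed, the shear can be recovered from the matrix, and its parameter
  from the strictly increasing Liouville series.\<close>

lemma step_inj:
  assumes "step (a, x) = step (a, y)" "0 < x" "0 < y"
  shows "x = y"
proof -
  have "e (level_of (snd a)) ** shear p q (liouville c x) = e (level_of (snd a)) ** shear p q (liouville c y)"
    using assms(1) matrix_inv_matrix_inv[OF det_level_matrix]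
    by (auto simp: step_def param_level_def Let_def split: if_splits) metis
  then have "matrix_inv (e (level_of (snd a))) ** (e (level_of (snd a)) ** shear p q (liouville c x)) =
      matrix_inv (e (level_of (snd a))) ** (e (level_of (snd a)) ** shear p q (liouville c y))"
    by simp
  then have "shear p q (liouville c x) = shear p q (liouville c y)"
    by (simp add: matrix_mul_assoc matrix_inv_SL e_det)
  then have "shear p q (liouville c x) $ p $ q = shear p q (liouville c y) $ p $ q"
    by simp
  then have "liouville c x = liouville c y"
    by (simp add: shear_nth)
  then show ?thesis
    using liouville_strict_mono[of c x y] liouville_strict_mono[of c y x] assms c_gt_1
    by (cases x y rule: linorder_cases) auto
qed

lemma singleton_SL_sets: "det g = 1 \<Longrightarrow> {g} \<in> sets (SL_borel :: (real^'n^'n) measure)"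
  by (auto simp: SL_borel_def sets_restrict_space intro!: image_eqI[of _ _ "{g}"])

lemma no_atoms_\<mu>: "no_atoms \<mu>"
  unfolding no_atoms_def
proof
  fix g assume "g \<in> space \<mu>"
  then have "{g} \<in> sets SL_borel"
    by (simp add: singleton_SL_sets space_\<mu>)
  then have "emeasure \<mu> {g} = emeasure step_params (step -` {g} \<inter> space step_params)"
    unfolding \<mu>_def by (rule emeasure_distr[OF step_measurable])
  also have "\<dots> = 0"
  proof (rule step_params_slice_null)
    show "step -` {g} \<inter> space step_params \<in> sets step_params"
      using \<open>{g} \<in> sets SL_borel\<close> by (rule measurable_sets[OF step_measurable])
    fix a
    have "x = y" if "x \<in> Pair a -` (step -` {g} \<inter> space step_params)" "y \<in> Pair a -` (step -` {g} \<inter> space step_params)" for x y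
      using that by (intro step_inj[of a]) (auto simp: space_step_params split: if_splits)
    then show "\<exists>x0. Pair a -` (step -` {g} \<inter> space step_params) \<subseteq> {x0}"
      by blast
  qed
  finally show "emeasure \<mu> {g} = 0" .
qed

text \<open>An open set contains some \<open>e j\<close> by density. Level \<open>j\<close> has
  positive probability, and small parameters perturb \<open>e j\<close> little, so a box of positive
  measure is mapped into the set.\<close>

lemma full_support_\<mu>: "measure_support SL_top \<mu> = carrier SL"
proof -
  interpret U: slow_level uniform_01 level_of by (rule slow_level_uniform)
  have "emeasure \<mu> W > 0" if W: "openin SL_top W" "g \<in> W" for W g
  proof -
    obtain V where V: "open V" "W = {g. det g = 1} \<inter> V"
      using W(1) by (auto simp: SL_top_def openin_open SL_def)
    then obtain j where j: "e j \<in> V"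
      using e_dense[of V] W(2) by blast
    have "continuous_on UNIV (\<lambda>t. e j ** shear p q t)"
      by (intro continuous_intros)
    then have "open ((\<lambda>t. e j ** shear p q t) -` V)"
      using open_vimage[OF V(1)] by blast
    moreover have "0 \<in> (\<lambda>t. e j ** shear p q t) -` V"
      using j by (simp add: shear_0)
    ultimately obtain d where d: "d > 0" "ball 0 d \<subseteq> (\<lambda>t. e j ** shear p q t) -` V"
      using openE by blast
    \<comment> \<open>Together with \<open>liouville_le\<close>, \<open>2 * a < d\<close> keeps the
      shear parameter inside the ball.\<close>
    define a where "a = min 1 (d / 3)"
    have a: "0 < a" "a \<le> 1" "2 * a < d"
      using d(1) by (auto simp: a_def)
    define D where "D = {0<..a}"
    have D: "D \<in> sets borel" "D \<subseteq> {0<..1}"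
    proof -
      show "D \<subseteq> {0<..1}"
        unfolding D_def using a(2) by (intro subsetI) (unfold greaterThanAtMost_iff, linarith)
    qed (simp add: D_def)
    have "D \<in> sets uniform_01"
      using D unfolding uniform_01_def sets_restrict_space by (auto intro!: image_eqI[of _ _ D])
    have "emeasure uniform_01 D = ennreal a"
      using emeasure_uniform_01[OF D] a(1) by (simp add: D_def)
    have sub: "({True} \<times> U.level j) \<times> D \<subseteq> step -` W \<inter> space step_params"
    proof clarify
      fix s u x assume ux: "u \<in> U.level j" "x \<in> D"
      have x: "0 < x" "x \<le> a"
        using ux(2) by (simp_all add: D_def)
      have u: "0 < u" "u \<le> 1" "level_of u = j"
        using ux(1) by (simp_all add: U.level_def)
      have "liouville c x \<in> ball 0 d"
        using liouville_le[of c x] liouville_nonneg[of c x] x a c_gt_1 by simp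
      then have "e j ** shear p q (liouville c x) \<in> V"
        using d(2) by blast
      then have "step ((True, u), x) \<in> W"
        using u V(2) by (simp add: step_def param_level_def det_level_matrix)
      then show "((True, u), x) \<in> step -` W \<inter> space step_params"
        using u x a by (simp add: space_step_params)
    qed
    have Wsets: "W \<in> sets SL_borel"
      unfolding V(2) by (rule open_Int_SL_sets[OF V(1)])
    have "0 < emeasure fair_coin {True}"
      unfolding fair_coin_def by (simp add: emeasure_pmf_single_eq_zero_iff zero_less_iff_neq_zero)
    then have "0 < emeasure fair_coin {True} * emeasure uniform_01 (U.level j) * emeasure uniform_01 D"
      using U.prob_level_pos[of j] a(1) \<open>emeasure uniform_01 D = ennreal a\<close> U.emeasure_eq_measure
      by (simp add: ennreal_zero_less_mult_iff)
    also have "\<dots> = emeasure step_params (({True} \<times> U.level j) \<times> D)"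
      using emeasure_step_params_Times[OF U.level_sets \<open>D \<in> sets uniform_01\<close>] by simp
    also have "\<dots> \<le> emeasure step_params (step -` W \<inter> space step_params)"
      using sub measurable_sets[OF step_measurable Wsets] by (rule emeasure_mono)
    also have "\<dots> = emeasure \<mu> W"
      unfolding \<mu>_def by (rule emeasure_distr[symmetric, OF step_measurable Wsets])
    finally show ?thesis .
  qed
  moreover have "topspace SL_top = (carrier SL :: (real^'n^'n) set)"
    by (simp add: SL_top_def)
  ultimately show ?thesis
    unfolding measure_support_def by auto
qed

text \<open>The two shapes of a step at record level, the diagonal matrix times a near factor or a
  near factor times its inverse, expressed through the matrix alone because the law does not reveal
  coin and level.\<close>

definition big :: "nat \<Rightarrow> (real^'n^'n) set" where
  "big j = {g. det g = 1 \<and> (two_diag p q (1 / big_factor c j) ** g \<in> near j \<or>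
     g ** two_diag p q (big_factor c j) \<in> near j)}"

lemma denom_gt_1: "denom c j > 1"
  using denom_ge[of c j] c_gt_1 by linarith

lemma big_factor_ge_1: "big_factor c j \<ge> 1"
  unfolding big_factor_def using denom_gt_1[of j] by (intro one_le_power) linarith

lemma two_diag_inv:
  "two_diag p q (1 / big_factor c j) ** two_diag p q (big_factor c j) = mat 1"
  "two_diag p q (big_factor c j) ** two_diag p q (1 / big_factor c j) = mat 1"
  using two_diag_mult_inverse[of "big_factor c j"] two_diag_mult_inverse[of "1 / big_factor c j"]
    big_factor_ge_1[of j] by auto

lemma det_big_diag:
  "det (two_diag p q (big_factor c j)) = 1" "det (two_diag p q (1 / big_factor c j)) = 1"
  using big_factor_ge_1[of j] by (auto intro!: det_two_diag pq)

lemma near_sets: "near j \<in> sets SL_borel"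
  unfolding near_def by (rule near_rational_sets)

lemma big_sets: "big j \<in> sets SL_borel"
proof -
  have 1: "(\<lambda>g. two_diag p q (1 / big_factor c j) ** g) \<in> measurable SL_borel SL_borel"
    by (intro continuous_measurable_SL continuous_intros) (simp add: det_mul det_big_diag)
  have 2: "(\<lambda>g. g ** two_diag p q (big_factor c j)) \<in> measurable SL_borel SL_borel"
    by (intro continuous_measurable_SL continuous_intros) (simp add: det_mul det_big_diag)
  have "big j = ((\<lambda>g. two_diag p q (1 / big_factor c j) ** g) -` near j \<inter> space SL_borel) \<union>
      ((\<lambda>g. g ** two_diag p q (big_factor c j)) -` near j \<inter> space SL_borel)"
    by (auto simp: big_def space_SL_borel)
  then show ?thesis
    using measurable_sets[OF 1 near_sets] measurable_sets[OF 2 near_sets] by simp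
qed

lemma step_near: "w \<in> space step_params \<Longrightarrow> param_level w < j \<Longrightarrow> step w \<in> near j"
  using level_matrix_near[of "param_level w" j "snd w"] near_rational_inv
  by (auto simp: step_def Let_def near_def space_step_params)

lemma step_big:
  assumes "w \<in> space step_params" "param_level w = j" "j \<notin> range (power 2)"
  shows "step w \<in> big j"
proof -
  define u where "u = shear p q (liouville c (snd w))"
  have u: "u \<in> near j"
    unfolding u_def using assms(1) by (intro shear_near) (auto simp: space_step_params)
  have det: "det (step w) = 1"
    by (rule det_step)
  show ?thesis
  proof (cases "fst (fst w)")
    case True
    then have "step w = two_diag p q (big_factor c j) ** u"
      using assms(2) e_big[OF assms(3)] by (simp add: step_def u_def)
    then have "two_diag p q (1 / big_factor c j) ** step w = u"
      by (simp add: matrix_mul_assoc two_diag_inv)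
    then show ?thesis
      using u det by (simp add: big_def)
  next
    case False
    have "matrix_inv (two_diag p q (big_factor c j)) = two_diag p q (1 / big_factor c j)"
      by (rule matrix_inv_eqI) (rule two_diag_inv)
    moreover have "det u = 1"
      by (simp add: u_def det_shear[OF pq])
    ultimately have "step w = matrix_inv u ** two_diag p q (1 / big_factor c j)"
      using False assms(2) e_big[OF assms(3)]
      by (simp add: step_def u_def matrix_inv_mult det_big_diag)
    then have "step w ** two_diag p q (big_factor c j) = matrix_inv u"
      by (simp add: two_diag_inv flip: matrix_mul_assoc)
    then show ?thesis
      using near_rational_inv[OF u[unfolded near_def]] det by (simp add: big_def near_def)
  qed
qed

text \<open>No lattice occurs here, so one almost sure event serves all points of
  \<open>limit_points\<close>. The conditions are countably many and use measurable sets of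
  matrices.\<close>

definition has_record :: "(nat \<Rightarrow> real^'n^'n) \<Rightarrow> nat \<Rightarrow> bool" where
  "has_record \<gamma> n \<longleftrightarrow> (\<exists>k<n. \<exists>j\<ge>n. \<gamma> k \<in> big j \<and> (\<forall>i<n. i \<noteq> k \<longrightarrow> \<gamma> i \<in> near j))"

text \<open>Once the diagonal matrix is isolated in \<open>\<gamma> k\<close>, the other factors
  form a left and a right product. The near part of \<open>\<gamma> k\<close> joins the right one
  for \<open>D\<close> and the left one for its inverse; either way each side has at most
  \<open>Suc j\<close> near factors.\<close>

lemma record_short_vector:
  assumes k: "k < n" "n \<le> j" "\<gamma> k \<in> big j" "\<And>i. i < n \<Longrightarrow> i \<noteq> k \<Longrightarrow> \<gamma> i \<in> near j" and g: "g \<in> near j"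
  shows "\<exists>z. int_vec z \<and> z \<noteq> 0 \<and> norm ((prefix_prod \<gamma> n ** g) *v z) \<le> 2 * (1 + real CARD('n)) / real j"
proof -
  define R where "R = real (denom c j)"
  define m where "m = R ^ 2"
  define d where "d = denom_tol c j"
  define b where "b = big_factor c j"
  have "c \<le> denom c j"
    using denom_ge c_gt_1 by simp
  then have R: "R \<ge> 2" "R \<ge> real CARD('n)"
    using c c_gt_1 by (auto simp: R_def)
  have m: "m \<ge> 2" "m \<in> \<int>" "norm (mat 1 :: real^'n^'n) \<le> m"
  proof -
    have "R * 1 \<le> R * R"
      using R by (intro mult_left_mono) auto
    then show "m \<ge> 2" "norm (mat 1 :: real^'n^'n) \<le> m"
      using R norm_mat_1_le[where 'n = 'n] unfolding m_def power2_eq_square by linarith+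
  qed (simp add: m_def R_def)
  have d: "0 < d" "d \<le> 1"
    using R by (auto simp: d_def denom_tol_def R_def)
  have near: "near j = near_rational m d"
    by (simp add: near_def m_def d_def R_def)
  define P where "P = prefix_prod \<gamma> k"
  define W where "W = prefix_prod (\<lambda>i. \<gamma> (i + Suc k)) (n - Suc k)"
  have P: "P \<in> near_rational_prod m d k"
    unfolding P_def using k m d by (intro prefix_prod_near_rational) (auto simp: near)
  have "W \<in> near_rational_prod m d (n - Suc k)"
    unfolding W_def using k m d by (intro prefix_prod_near_rational) (auto simp: near)
  then have Wg: "W ** g \<in> near_rational_prod m d (Suc (n - Suc k))"
    using g m d by (intro near_rational_prod_mult_right) (auto simp: near)
  have split: "prefix_prod \<gamma> n ** g = P ** \<gamma> k ** (W ** g)"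
    unfolding P_def W_def using prefix_prod_split[OF k(1), of \<gamma>] by (simp add: matrix_mul_assoc)
  define M where "M = m ^ (j + 2)"
  have M: "M = R ^ (2 * j + 4)"
    unfolding M_def m_def power_mult[symmetric] by (rule arg_cong[where f = "power R"]) simp
  define \<epsilon> where "\<epsilon> = m ^ (2 * Suc j + 2) * d"
  have prodj: "near_rational_prod m d (Suc j) = near_rational M \<epsilon>"
    by (simp add: near_rational_prod_def M_def \<epsilon>_def)
  have b: "b = M ^ 3"
    by (simp add: b_def big_factor_def M R_def flip: power_mult)
  \<comment> \<open>Accumulation over the product multiplies the tolerance \<open>1 / M ^ 9\<close>
    by \<open>m ^ (2 * j + 4) = M ^ 2\<close>.\<close>
  have \<epsilon>: "\<epsilon> = 1 / M ^ 7"
  proof -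
    have "R ^ (18 * j + 36) = M ^ 7 * m ^ (2 * Suc j + 2)"
      unfolding M m_def power_mult[symmetric] power_add[symmetric] by (rule arg_cong[where f = "power R"]) simp
    moreover have "m ^ (2 * Suc j + 2) > 0"
      using m(1) by (intro zero_less_power) linarith
    ultimately show ?thesis
      unfolding \<epsilon>_def d_def denom_tol_def R_def[symmetric] using m(1) by auto
  qed
  have "M \<in> \<int>"
    unfolding M_def by (rule Ints_power[OF m(2)])
  have "M \<ge> 1"
    unfolding M_def using m(1) by (intro one_le_power) linarith
  have "real j \<le> R"
    using denom_ge_index[of c j] c_gt_1 by (simp add: R_def)
  also have "R \<le> M"
    unfolding M using R by (intro self_le_power) auto
  finally have jM: "real j \<le> M" .
  have "b \<ge> 1"
    unfolding b_def by (rule big_factor_ge_1)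
  then have "b > 0"
    by linarith
  have *: "\<exists>z. int_vec z \<and> z \<noteq> 0 \<and> norm ((P' ** D ** G) *v z) \<le> 2 * (1 + real CARD('n)) / real j"
    if PG: "P' \<in> near_rational_prod m d (Suc j)" "G \<in> near_rational_prod m d (Suc j)"
      and D: "D *v axis i 1 = (1 / b) *s axis i 1" "norm D \<le> real CARD('n) * b" for P' D G :: "real^'n^'n" and i
  proof -
    obtain z where z: "int_vec z" "z \<noteq> 0"
      "norm ((P' ** D ** G) *v z) \<le> (M + \<epsilon>) * (M / b + real CARD('n) * b * M\<^sup>2 * \<epsilon>)"
      using short_vector[OF PG[unfolded prodj] D \<open>M \<in> \<int>\<close> \<open>M \<ge> 1\<close> \<open>b > 0\<close> of_nat_0_le_iff] by blast
    have "(M + \<epsilon>) * (M / b + real CARD('n) * b * M\<^sup>2 * \<epsilon>) \<le> 2 * (1 + real CARD('n)) / M"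
      by (rule record_bound[OF \<open>M \<ge> 1\<close> b \<epsilon>]) simp
    also have "\<dots> \<le> 2 * (1 + real CARD('n)) / real j"
      using jM k by (intro divide_left_mono mult_pos_pos) auto
    finally have "(M + \<epsilon>) * (M / b + real CARD('n) * b * M\<^sup>2 * \<epsilon>) \<le> 2 * (1 + real CARD('n)) / real j" .
    from order_trans[OF z(3) this] z(1,2) show ?thesis
      by (intro exI[of _ z] conjI)
  qed
  have mono: "X \<in> near_rational_prod m d (Suc j)" if "X \<in> near_rational_prod m d l" "l \<le> Suc j" for X :: "real^'n^'n" and l
    by (rule near_rational_prod_mono[OF that m(1) d(1) m(2)])
  consider "two_diag p q (1 / b) ** \<gamma> k \<in> near j" | "\<gamma> k ** two_diag p q b \<in> near j"
    using k(3) by (auto simp: big_def b_def)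
  then show ?thesis
  proof cases
    case 1
    define u where "u = two_diag p q (1 / b) ** \<gamma> k"
    have "\<gamma> k = two_diag p q b ** u"
      by (simp add: u_def b_def matrix_mul_assoc two_diag_inv)
    then have eq: "prefix_prod \<gamma> n ** g = P ** two_diag p q b ** (u ** (W ** g))"
      using split by (simp add: matrix_mul_assoc)
    \<comment> \<open>The factors after position \<open>k\<close>, then \<open>u\<close> and
      \<open>g\<close>, number \<open>n - k + 1\<close>, which is at most \<open>Suc j\<close>; this
      extremal case fixes the exponent in \<open>M\<close>.\<close>
    have "u ** (W ** g) \<in> near_rational_prod m d (Suc (Suc (n - Suc k)))"
      using 1 by (intro near_rational_prod_mult_left[OF Wg _ m(1) d]) (simp add: near u_def)
    then have "u ** (W ** g) \<in> near_rational_prod m d (Suc j)"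
      using k by (intro mono) auto
    moreover have "P \<in> near_rational_prod m d (Suc j)"
      using k by (intro mono[OF P]) auto
    ultimately show ?thesis
      unfolding eq by (intro *[OF _ _ two_diag_axis(1)[OF \<open>b > 0\<close> pq] norm_two_diag(1)[OF \<open>b \<ge> 1\<close>]])
  next
    case 2
    define u where "u = \<gamma> k ** two_diag p q b"
    have "\<gamma> k = u ** two_diag p q (1 / b)"
      by (simp add: u_def b_def two_diag_inv flip: matrix_mul_assoc)
    then have eq: "prefix_prod \<gamma> n ** g = (P ** u) ** two_diag p q (1 / b) ** (W ** g)"
      using split by (simp add: matrix_mul_assoc)
    have "P ** u \<in> near_rational_prod m d (Suc k)"
      using 2 by (intro near_rational_prod_mult_right[OF P _ m(1) d]) (simp add: near u_def)
    then have "P ** u \<in> near_rational_prod m d (Suc j)"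
      using k by (intro mono) auto
    moreover have "W ** g \<in> near_rational_prod m d (Suc j)"
      using k by (intro mono[OF Wg]) auto
    ultimately show ?thesis
      unfolding eq by (intro *[OF _ _ two_diag_axis(2)[OF \<open>b > 0\<close> pq] norm_two_diag(2)[OF \<open>b \<ge> 1\<close>]])
  qed
qed

lemma det_prefix_prod: "(\<And>i. i < n \<Longrightarrow> det (\<gamma> i) = 1) \<Longrightarrow> det (prefix_prod \<gamma> n) = 1"
  by (induction n) (auto simp: det_mul)

text \<open>The record level \<open>j\<close> is at least \<open>n\<close>, hence eventually beyond
  the threshold of \<open>x\<close>, so \<open>x\<close> has a representative adapted to that very
  level.\<close>

lemma records_tend_to_infinity:
  assumes "\<forall>\<^sub>F n in sequentially. has_record \<gamma> n" "x \<in> limit_points"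
  shows "tends_to_infinity X_top (\<lambda>n. prefix_prod \<gamma> n <#\<^bsub>SL\<^esub> x)"
proof (rule tends_to_infinity_X_topI)
  show "(\<lambda>n. 2 * (1 + real CARD('n)) / real n) \<longlonglongrightarrow> 0"
    by real_asymp
  obtain j0 where j0: "\<And>j. j > j0 \<Longrightarrow> x \<in> (\<lambda>g. g <#\<^bsub>SL\<^esub> SLZ) ` near j"
    using assms(2) by (auto simp: limit_points_def)
  have "\<forall>\<^sub>F n in sequentially. n > j0"
    by (rule eventually_gt_at_top)
  with assms(1) show "\<forall>\<^sub>F n in sequentially. \<exists>g z. det g = 1 \<and> prefix_prod \<gamma> n <#\<^bsub>SL\<^esub> x = g <#\<^bsub>SL\<^esub> SLZ \<and>
      int_vec z \<and> z \<noteq> 0 \<and> norm (g *v z) \<le> 2 * (1 + real CARD('n)) / real n"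
  proof eventually_elim
    case (elim n)
    then obtain k j where k: "k < n" "n \<le> j" "\<gamma> k \<in> big j" "\<And>i. i < n \<Longrightarrow> i \<noteq> k \<Longrightarrow> \<gamma> i \<in> near j"
      unfolding has_record_def by blast
    obtain g where g: "g \<in> near j" "x = g <#\<^bsub>SL\<^esub> SLZ"
      using j0[of j] k(2) elim(2) by auto
    obtain z where z: "int_vec z" "z \<noteq> 0" "norm ((prefix_prod \<gamma> n ** g) *v z) \<le> 2 * (1 + real CARD('n)) / real j"
      using record_short_vector[of k n j \<gamma> g] k g(1) by blast
    have "2 * (1 + real CARD('n)) / real j \<le> 2 * (1 + real CARD('n)) / real n"
      using k by (intro divide_left_mono mult_pos_pos) auto
    then have "norm ((prefix_prod \<gamma> n ** g) *v z) \<le> 2 * (1 + real CARD('n)) / real n"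
      using z(3) by linarith
    moreover have "det (\<gamma> i) = 1" if "i < n" for i
      using k(3) k(4)[OF that] by (cases "i = k") (auto simp: big_def near_def dest: near_rational_det)
    then have "det (prefix_prod \<gamma> n ** g) = 1"
      using g(1) by (simp add: det_mul det_prefix_prod near_def near_rational_det)
    ultimately show ?case
      using z action_coset[of "prefix_prod \<gamma> n" g] g(2) by auto
  qed
qed

text \<open>Levels are visible only in the parameters, so the unique record is found there and then
  pushed forward to the sequence of matrices.\<close>

lemma AE_records: "AE \<gamma> in (\<Pi>\<^sub>M i\<in>(UNIV :: nat set). \<mu>). \<forall>\<^sub>F n in sequentially. has_record \<gamma> n"
proof -
  interpret L: slow_level step_params param_level
    by (rule slow_level_step_params)
  let ?N = "\<Pi>\<^sub>M i\<in>(UNIV :: nat set). (SL_borel :: (real^'n^'n) measure)"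
  let ?t = "\<lambda>\<omega>. \<lambda>i\<in>(UNIV :: nat set). step (\<omega> i)"
  have distr: "(\<Pi>\<^sub>M i\<in>(UNIV :: nat set). \<mu>) = distr L.seq ?N ?t"
    unfolding \<mu>_def by (rule distr_PiM_map[symmetric, OF prob_space_step_params step_measurable])
  have t: "?t \<in> measurable L.seq ?N"
  proof (rule measurable_restrict)
    fix i :: nat
    show "(\<lambda>\<omega>. step (\<omega> i)) \<in> measurable L.seq SL_borel"
      using measurable_compose[OF measurable_component_singleton[of i UNIV "\<lambda>_. step_params"] step_measurable]
      by simp
  qed
  have comp: "{\<gamma>\<in>space ?N. \<gamma> k \<in> X} \<in> sets ?N" if "X \<in> sets SL_borel" for k X
  proof -
    have "(\<lambda>\<gamma>. \<gamma> k) -` X \<inter> space ?N \<in> sets ?N"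
      by (rule measurable_sets[OF _ that]) (rule measurable_component_singleton, simp)
    moreover have "{\<gamma>\<in>space ?N. \<gamma> k \<in> X} = (\<lambda>\<gamma>. \<gamma> k) -` X \<inter> space ?N"
      by blast
    ultimately show ?thesis
      by simp
  qed
  \<comment> \<open>Transport along \<open>distr\<close> requires a measurable event; the
    quantifiers here range over natural numbers only.\<close>
  have *: "{\<gamma>\<in>space ?N. \<forall>\<^sub>F n in sequentially. has_record \<gamma> n} \<in> sets ?N"
    unfolding has_record_def eventually_sequentially
    by (intro sets.sets_Collect_countable_Ex sets.sets_Collect_countable_All sets.sets_Collect_conj
        sets.sets_Collect_imp sets.sets_Collect_const comp near_sets big_sets)
  have "AE \<omega> in L.seq. \<forall>\<^sub>F n in sequentially. has_record (?t \<omega>) n"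
    using L.AE_unique_record AE_space
  proof eventually_elim
    case (elim \<omega>)
    have \<omega>: "\<omega> i \<in> space step_params" for i
      using elim(2) by (auto simp: space_PiM)
    show ?case
      using elim(1)
    proof eventually_elim
      case (elim n)
      then obtain k where k: "k < n" "n \<le> param_level (\<omega> k)" "param_level (\<omega> k) \<notin> range (power 2)"
        "\<And>i. i < n \<Longrightarrow> i \<noteq> k \<Longrightarrow> param_level (\<omega> i) < param_level (\<omega> k)"
        by blast
      define j where "j = param_level (\<omega> k)"
      have "step (\<omega> k) \<in> big j"
        using step_big[OF \<omega> _ k(3)] by (simp add: j_def)
      moreover have "\<forall>i<n. i \<noteq> k \<longrightarrow> step (\<omega> i) \<in> near j"
        using step_near[OF \<omega>] k(4) by (simp add: j_def)
      moreover have "n \<le> j"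
        using k(2) by (simp add: j_def)
      ultimately show ?case
        unfolding has_record_def restrict_UNIV using k(1) by blast
    qed
  qed
  then show ?thesis
    unfolding distr AE_distr_iff[OF t *] .
qed

end

theorem theorem1p4:
  assumes "CARD('n::finite) \<ge> 2"
  shows "\<exists>(S :: (real^'n^'n) set set) (\<mu> :: (real^'n^'n) measure).
    S \<subseteq> topspace X_top \<and> uncountable S \<and> X_top closure_of S = topspace X_top \<and>
    S \<in> sets (borel_of_topology X_top) \<and>
    SL_prob \<mu> \<and> symmetric_measure \<mu> \<and> no_atoms \<mu> \<and>
    measure_support SL_top \<mu> = carrier SL \<and>
    (AE \<gamma> in \<Pi>\<^sub>M i\<in>(UNIV :: nat set). \<mu>.
       \<forall>x\<in>S. tends_to_infinity X_top (\<lambda>n. prefix_prod \<gamma> n <#\<^bsub>SL\<^esub> x))"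
proof -
  have "\<exists>p q :: 'n. p \<noteq> q"
  proof (rule ccontr)
    assume "\<not> ?thesis"
    then have "card (UNIV :: 'n set) \<le> Suc 0"
      by (subst card_le_Suc0_iff_eq) auto
    then show False
      using assms by linarith
  qed
  then obtain p q :: 'n where "p \<noteq> q"
    by blast
  \<comment> \<open>The least start of \<open>denom\<close> above the dimension.\<close>
  define c where "c = Suc CARD('n)"
  have c: "CARD('n) < c"
    by (simp add: c_def)
  obtain e :: "nat \<Rightarrow> real^'n^'n" where e:
    "\<forall>j. det (e j) = 1 \<and> (\<exists>h'. int_height (real (denom c (Suc j))) (e j) h')"
    "\<forall>j. j \<notin> range (power 2) \<longrightarrow> e j = two_diag p q (big_factor c j)"
    "\<forall>U. open U \<and> U \<inter> {g. det g = 1} \<noteq> {} \<longrightarrow> (\<exists>j. e j \<in> U)"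
    using level_matrices_exist[OF c \<open>p \<noteq> q\<close>] by (elim exE conjE)
  interpret heavy_walk p q c e
    by (rule heavy_walk.intro[OF \<open>p \<noteq> q\<close> c e(1)[rule_format, THEN conjunct1]
        e(1)[rule_format, THEN conjunct2] e(2)[rule_format] e(3)[rule_format, OF conjI]])
  have "AE \<gamma> in \<Pi>\<^sub>M i\<in>(UNIV :: nat set). \<mu>.
      \<forall>x\<in>limit_points. tends_to_infinity X_top (\<lambda>n. prefix_prod \<gamma> n <#\<^bsub>SL\<^esub> x)"
    using AE_records by eventually_elim (blast intro: records_tend_to_infinity)
  with limit_points_subset uncountable_limit_points dense_limit_points limit_points_measurable
    SL_prob_\<mu> symmetric_\<mu> no_atoms_\<mu> full_support_\<mu>
  show ?thesis
    by (intro exI[of _ limit_points] exI[of _ \<mu>] conjI)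
qed

end
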